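(* Let $F_2$ be the free group on $\{a,b\}$. The set of free bases of $F_2$ and the set of primitive elements of $F_2$, written as reduced words over $\{a,b,a^{-1},b^{-1}\}$, are EDT0L languages. That is, both $\{w_1\#w_2\mid w_1,w_2\text{ reduced words},\ (w_1,w_2)\text{ is a free basis of }F_2\}\subseteq\{a,b,a^{-1},b^{-1},\#\}^*$ and $\{w\mid w\text{ a reduced word representing a primitive element of }F_2\}\subseteq\{a,b,a^{-1},b^{-1}\}^*$ are EDT0L.
   Context: A free basis of a free group is a tuple of elements that freely generate the group; a primitive element is an element that belongs to some free basis. Tuples of words $(w_1,\dots,w_t)$ are encoded as strings $w_1\#\cdots\#w_t$, where $\#$ is an extra symbol. All alphabets are finite. A deterministic table over an alphabet $C$ is an endomorphism $h$ of the free monoid $C^*$. A language $L\subseteq A^*$ is EDT0L if there are an alphabet $C\supseteq A$, a finite set $H$ of endomorphisms of $C^*$, a regular language $\mathcal R\subseteq H^*$ and a letter $c\in C$ such that $L=\{w\in A^*\mid w \text{ is obtained from } c \text{ by applying successively, from left to right, the maps } h_1,\dots,h_n \text{ for some } h_1h_2\cdots h_n\in\mathcal R\}$. *)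

theory Defs
  imports "HOL-Algebra.Group"
begin

text \<open>The letter \<open>(x, True)\<close> stands for the generator \<open>x\<close> and \<open>(x, False)\<close> for its formal inverse.\<close>

type_synonym 'x letter = "'x \<times> bool"

definition inv_letter :: "'x letter \<Rightarrow> 'x letter" where
  "inv_letter l = (fst l, \<not> snd l)"

definition reduced :: "'x letter list \<Rightarrow> bool" where
  "reduced w \<longleftrightarrow> successively (\<lambda>k l. l \<noteq> inv_letter k) w"

definition cons_reduce :: "'x letter \<Rightarrow> 'x letter list \<Rightarrow> 'x letter list" where
  "cons_reduce l w = (if w \<noteq> [] \<and> hd w = inv_letter l then tl w else l # w)"

text \<open>The freely reduced form of a word, obtained by prepending its letters one at a time, from
  right to left, and cancelling.\<close>

definition reduce :: "'x letter list \<Rightarrow> 'x letter list" where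
  "reduce w = foldr cons_reduce w []"

definition free_group :: "'x set \<Rightarrow> 'x letter list monoid" where
  "free_group X =
     \<lparr>carrier = {w. reduced w \<and> fst ` set w \<subseteq> X}, mult = (\<lambda>u v. reduce (u @ v)), one = []\<rparr>"

lemma inv_letter_inv_letter [simp]: "inv_letter (inv_letter l) = l"
  by (simp add: inv_letter_def)

lemma reduced_Nil [simp]: "reduced []"
  by (simp add: reduced_def)

lemma reduced_Cons: "reduced (l # w) \<longleftrightarrow> reduced w \<and> (w \<noteq> [] \<longrightarrow> hd w \<noteq> inv_letter l)"
  by (cases w) (auto simp: reduced_def)

lemma reduced_cons_reduce: "reduced w \<Longrightarrow> reduced (cons_reduce l w)"
  by (cases w) (auto simp: cons_reduce_def reduced_Cons)

lemma reduced_foldr: "reduced v \<Longrightarrow> reduced (foldr cons_reduce u v)"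
  by (induction u) (auto intro: reduced_cons_reduce)

lemma reduced_reduce: "reduced (reduce w)"
  by (simp add: reduce_def reduced_foldr)

lemma set_cons_reduce: "set (cons_reduce l w) \<subseteq> insert l (set w)"
  by (cases w) (auto simp: cons_reduce_def)

lemma set_reduce: "set (reduce w) \<subseteq> set w"
  unfolding reduce_def using set_cons_reduce by (induction w) fastforce+

lemma reduce_reduced: "reduced w \<Longrightarrow> reduce w = w"
  unfolding reduce_def by (induction w) (auto simp: reduced_Cons cons_reduce_def)

lemma cons_reduce_cancel: "reduced w \<Longrightarrow> cons_reduce l (cons_reduce (inv_letter l) w) = w"
  by (cases w) (auto simp: cons_reduce_def reduced_Cons)

lemma foldr_cons_reduce:
  assumes "reduced v"
  shows "foldr cons_reduce (cons_reduce l u) v = cons_reduce l (foldr cons_reduce u v)"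
proof (cases "u \<noteq> [] \<and> hd u = inv_letter l")
  case True
  then have "u = inv_letter l # tl u" "cons_reduce l u = tl u"
    by (cases u; simp add: cons_reduce_def)+
  then show ?thesis
    using cons_reduce_cancel [OF reduced_foldr [OF assms], of l "tl u"]
    by (metis foldr.simps(2) o_apply)
next
  case False
  then show ?thesis by (auto simp: cons_reduce_def [of l u])
qed

lemma reduce_reduce_append: "reduce (reduce u @ v) = reduce (u @ v)"
proof -
  have "foldr cons_reduce (reduce u) (reduce v) = foldr cons_reduce u (reduce v)"
    by (induction u) (auto simp: reduce_def foldr_cons_reduce reduced_foldr)
  then show ?thesis by (simp add: reduce_def)
qed

lemma reduce_append_reduce: "reduce (u @ reduce v) = reduce (u @ v)"
  using reduce_reduced [OF reduced_reduce, of v] by (simp add: reduce_def)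

lemma reduce_inverse: "reduce (rev (map inv_letter w) @ w) = []"
proof (induction w)
  case (Cons l w)
  have "cons_reduce (inv_letter l) (cons_reduce l (reduce w)) = reduce w"
    using cons_reduce_cancel [OF reduced_reduce, of "inv_letter l" w] by simp
  then show ?case using Cons by (simp add: reduce_def)
qed (simp add: reduce_def)

lemma group_free_group: "group (free_group X)"
proof (rule groupI)
  fix u v assume "u \<in> carrier (free_group X)" "v \<in> carrier (free_group X)"
  then show "u \<otimes>\<^bsub>free_group X\<^esub> v \<in> carrier (free_group X)"
    using set_reduce [of "u @ v"] by (fastforce simp: free_group_def reduced_reduce)
next
  fix u assume u: "u \<in> carrier (free_group X)"
  let ?v = "reduce (rev (map inv_letter u))"
  have "fst ` set ?v \<subseteq> X"
    using u set_reduce [of "rev (map inv_letter u)"]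
    by (fastforce simp: free_group_def inv_letter_def)
  then show "\<exists>v\<in>carrier (free_group X). v \<otimes>\<^bsub>free_group X\<^esub> u = \<one>\<^bsub>free_group X\<^esub>"
    by (intro bexI [of _ ?v])
      (auto simp: free_group_def reduced_reduce reduce_reduce_append reduce_inverse)
qed (auto simp: free_group_def reduce_reduced reduce_reduce_append reduce_append_reduce)

definition word_eval :: "('g, 'm) monoid_scheme \<Rightarrow> ('x \<Rightarrow> 'g) \<Rightarrow> 'x letter list \<Rightarrow> 'g" where
  "word_eval G f w =
     foldr (\<lambda>l g. (if snd l then f (fst l) else inv\<^bsub>G\<^esub> (f (fst l))) \<otimes>\<^bsub>G\<^esub> g) w \<one>\<^bsub>G\<^esub>"

definition free_basis :: "('g, 'm) monoid_scheme \<Rightarrow> 'g list \<Rightarrow> bool" where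
  "free_basis G gs \<longleftrightarrow>
     set gs \<subseteq> carrier G \<and> word_eval G (\<lambda>i. gs ! i) \<in> iso (free_group {..<length gs}) G"

definition primitive_element :: "('g, 'm) monoid_scheme \<Rightarrow> 'g \<Rightarrow> bool" where
  "primitive_element G g \<longleftrightarrow> (\<exists>gs. free_basis G gs \<and> g \<in> set gs)"

datatype gen = Gen_a | Gen_b

abbreviation F2 :: "gen letter list monoid" where
  "F2 \<equiv> free_group {Gen_a, Gen_b}"

datatype 'a hashed = Letter 'a | Hash

fun encode_tuple :: "'a list list \<Rightarrow> 'a hashed list" where
  "encode_tuple [] = []"
| "encode_tuple [w] = map Letter w"
| "encode_tuple (w # v # vs) = map Letter w @ Hash # encode_tuple (v # vs)"

text \<open>Acceptance by a complete deterministic finite automaton. Every finite state set can be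
  renamed to a set of natural numbers.\<close>

definition regular_language :: "'s set \<Rightarrow> 's list set \<Rightarrow> bool" where
  "regular_language S R \<longleftrightarrow>
     (\<exists>(Q :: nat set) \<delta> q0 F.
        finite Q \<and> q0 \<in> Q \<and> F \<subseteq> Q \<and> (\<forall>q\<in>Q. \<forall>s\<in>S. \<delta> q s \<in> Q) \<and>
        R = {w \<in> lists S. foldl \<delta> q0 w \<in> F})"

text \<open>Only the values on words over \<open>C\<close> matter.\<close>

definition free_monoid_endo :: "'c set \<Rightarrow> ('c list \<Rightarrow> 'c list) \<Rightarrow> bool" where
  "free_monoid_endo C h \<longleftrightarrow>
     h ` lists C \<subseteq> lists C \<and> h [] = [] \<and>
     (\<forall>u\<in>lists C. \<forall>v\<in>lists C. h (u @ v) = h u @ h v)"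

text \<open>The extended alphabet \<open>C\<close> lives in the type \<open>'a + nat\<close>, with \<open>A\<close> embedded by \<open>Inl\<close>: every
  finite alphabet containing \<open>A\<close> can be renamed in this way. The maps in \<open>hs\<close> are applied from left
  to right, the head of \<open>hs\<close> first.\<close>

definition EDT0L :: "'a set \<Rightarrow> 'a list set \<Rightarrow> bool" where
  "EDT0L A L \<longleftrightarrow> finite A \<and>
     (\<exists>(C :: ('a + nat) set) H R c.
        finite C \<and> Inl ` A \<subseteq> C \<and> c \<in> C \<and>
        finite H \<and> (\<forall>h\<in>H. free_monoid_endo C h) \<and> regular_language H R \<and>
        L = {w \<in> lists A. \<exists>hs\<in>R. fold (\<lambda>h u. h u) hs [c] = map Inl w})"

end

theory Submission
  imports Defs "HOL-Library.Countable" "HOL-Library.Z2"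
begin

text \<open>
  Read from right to left, an EDT0L derivation is the run of a machine with finitely many registers
  that hold words: every endomorphism overwrites all registers at once by concatenations of letters
  and old contents, the last endomorphism acts first, and the generated word ends up in the register of
  the start letter. So a language is EDT0L if it is what such a machine can store in one register
  (\<open>EDT0L_register_machine\<close>). EDT0L languages are closed under intersection with regular languages
  (\<open>EDT0L_Int_regular\<close>), and being a reduced word is a regular condition. It is therefore enough to
  have a machine that writes only bases, reduced or not, and among them every basis that consists of
  reduced words.

  Two facts about \<open>F\<^sub>2\<close> provide the machine. The first is a strong form of Nielsen's theorem
  (\<open>conj_positive_of_span\<close>): every basis arises from a positive basis, that is, from a pair of words
  obtained from \<open>(a, b)\<close> by swapping and by multiplying one component by the other without inverses,
  by choosing signs for the two generators, inverting components and conjugating both components by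
  the same \<open>g\<close>. For the proof one shows that the pairs of this form are closed under all Nielsen moves
  (\<open>conj_positive_add\<close>), and that a generating pair which no Nielsen move and conjugation
  makes shorter consists of two letters.

  The second fact describes the cancellation in \<open>(g p\<^sub>1 g\<inverse>, g p\<^sub>2 g\<inverse>)\<close> for a positive basis
  \<open>(p\<^sub>1, p\<^sub>2)\<close>. Take \<open>g\<close> as short as possible. After inverting everything, its last letter \<open>x\<close> is
  one of the positive letters, so that nothing cancels at the left of \<open>p\<^sub>i\<close>. If \<open>p\<^sub>1\<close> and \<open>p\<^sub>2\<close> both ended
  with \<open>x\<close>, then the pair \<open>(x p\<^sub>1 x\<inverse>, x p\<^sub>2 x\<inverse>)\<close> would again be a positive basis
  (\<open>positive_basis_rotate\<close>) and \<open>g\<close> could be shortened. So one of them, say \<open>p\<^sub>2\<close>, does not end with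
  \<open>x\<close>, and \<open>g p\<^sub>2 g\<inverse>\<close> is reduced. Splitting off from \<open>g\<close> the longest suffix that it shares
  with the powers of \<open>p\<^sub>1\<close> gives \<open>g = g' r p\<^sub>1\<^sup>k\<close> with \<open>p\<^sub>1 = p' r\<close>, and the reduced form of \<open>g p\<^sub>1 g\<inverse>\<close>
  is \<open>g' (r p') g'\<inverse>\<close>. Hence the machine has to build a positive basis together with an arbitrary
  cut \<open>p\<^sub>1 = p' r\<close>, a power of \<open>p\<^sub>1\<close> and an arbitrary word \<open>g'\<close>, and this can be done by
  concatenation (\<open>machine_reaches_cuts\<close>, \<open>machine_reaches_complete\<close>).

  Primitive elements are the components of the bases of length two, since all bases of \<open>F\<^sub>2\<close> have
  that length (\<open>freely_generates_F2_length\<close>); the same machine writes them if it outputs one component.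
\<close>

section \<open>Regular languages\<close>

text \<open>The Myhill--Nerode criterion: the values of \<open>K\<close> serve as the states of an automaton. This spares
  the explicit numbering of states by natural numbers in all later constructions.\<close>
lemma regular_language_finite_index:
  fixes K :: "'s list \<Rightarrow> 'k"
  assumes R: "R \<subseteq> lists S"
    and fin: "finite (K ` lists S)"
    and step: "\<And>u v s. \<lbrakk>u \<in> lists S; v \<in> lists S; s \<in> S; K u = K v\<rbrakk> \<Longrightarrow> K (u @ [s]) = K (v @ [s])"
    and final: "\<And>u v. \<lbrakk>u \<in> lists S; v \<in> lists S; K u = K v; u \<in> R\<rbrakk> \<Longrightarrow> v \<in> R"
  shows "regular_language S R"
proof -
  obtain f :: "'k \<Rightarrow> nat" where f: "inj_on f (K ` lists S)"
    using finite_imp_inj_to_nat_seg [OF fin] by blast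
  define rep where "rep q = (SOME w. w \<in> lists S \<and> f (K w) = q)" for q
  define \<delta> where "\<delta> q s = f (K (rep q @ [s]))" for q s
  have rep: "rep (f (K w)) \<in> lists S \<and> K (rep (f (K w))) = K w" if "w \<in> lists S" for w
  proof -
    have "rep (f (K w)) \<in> lists S \<and> f (K (rep (f (K w)))) = f (K w)"
      unfolding rep_def using someI [of "\<lambda>v. v \<in> lists S \<and> f (K v) = f (K w)" w] that by blast
    then show ?thesis using f that by (auto dest: inj_onD)
  qed
  have \<delta>: "\<delta> (f (K w)) s = f (K (w @ [s]))" if "w \<in> lists S" "s \<in> S" for w s
    unfolding \<delta>_def using step [of "rep (f (K w))" w s] rep [of w] that by simp
  have foldl: "foldl \<delta> (f (K [])) w = f (K w)" if "w \<in> lists S" for w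
    using that by (induction w rule: rev_induct) (auto simp: \<delta>)
  have "w \<in> R \<longleftrightarrow> f (K w) \<in> (f \<circ> K) ` R" if "w \<in> lists S" for w
  proof
    assume "f (K w) \<in> (f \<circ> K) ` R"
    then obtain v where v: "v \<in> R" "f (K w) = f (K v)" by auto
    moreover have "v \<in> lists S" using R v by blast
    ultimately have "K v = K w" using f that by (metis imageI inj_onD)
    then show "w \<in> R" using final \<open>v \<in> lists S\<close> that v(1) by blast
  qed auto
  then have "w \<in> R \<longleftrightarrow> w \<in> lists S \<and> foldl \<delta> (f (K [])) w \<in> (f \<circ> K) ` R" for w
    using R foldl by (metis subsetD)
  then have "R = {w \<in> lists S. foldl \<delta> (f (K [])) w \<in> (f \<circ> K) ` R}"
    by blast
  moreover have "finite (f ` K ` lists S)" using fin by simp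
  moreover have "\<delta> (f (K w)) s \<in> f ` K ` lists S" if "w \<in> lists S" "s \<in> S" for w s
    unfolding \<delta> [OF that] using that by (intro imageI) simp
  then have "\<forall>q \<in> f ` K ` lists S. \<forall>s\<in>S. \<delta> q s \<in> f ` K ` lists S"
    by blast
  ultimately show ?thesis
    unfolding regular_language_def
    by (intro exI [of _ "f ` K ` lists S"] exI [of _ \<delta>] exI [of _ "f (K [])"] exI [of _ "(f \<circ> K) ` R"])
      (use R in \<open>auto simp: image_comp\<close>)
qed

lemma regular_language_lists: "regular_language S (lists S)"
  by (rule regular_language_finite_index [where K = "\<lambda>_. ()"]) auto

text \<open>An automaton only has to remember the last letter, and whether a forbidden pair has occurred.\<close>
lemma regular_language_successively:
  assumes "finite S"
  shows "regular_language S {w \<in> lists S. successively P w}"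
proof (rule regular_language_finite_index)
  let ?K = "\<lambda>w. if successively P w then Some (if w = [] then None else Some (last w)) else None"
  have "?K w \<in> insert None (Some ` insert None (Some ` S))" if "w \<in> lists S" for w
    using that last_in_set [of w] by auto
  then have "?K ` lists S \<subseteq> insert None (Some ` insert None (Some ` S))" by (rule image_subsetI)
  then show "finite (?K ` lists S)" by (rule finite_subset) (use assms in auto)
  show "?K (u @ [s]) = ?K (v @ [s])" if "?K u = ?K v" for u v s
    using that by (auto simp: successively_append_iff split: if_splits)
next
  fix u v assume "v \<in> lists S" "u \<in> {w \<in> lists S. successively P w}" and
    "(if successively P u then Some (if u = [] then None else Some (last u)) else None) =
     (if successively P v then Some (if v = [] then None else Some (last v)) else None)"
  then show "v \<in> {w \<in> lists S. successively P w}" by (simp split: if_splits)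
qed blast

section \<open>Intersection of EDT0L languages with regular languages\<close>

lemma free_monoid_endo_lists:
  "\<lbrakk>free_monoid_endo C h; u \<in> lists C\<rbrakk> \<Longrightarrow> h u \<in> lists C"
  unfolding free_monoid_endo_def by blast

lemma fold_free_monoid_endo_lists:
  "\<lbrakk>\<forall>h\<in>set hs. free_monoid_endo C h; u \<in> lists C\<rbrakk> \<Longrightarrow> fold (\<lambda>h. h) hs u \<in> lists C"
  by (induction hs arbitrary: u) (auto simp: free_monoid_endo_lists simp del: in_lists_conv_set)

text \<open>Only the regular control of the endomorphisms changes. Let \<open>\<delta>\<close> be an automaton for \<open>M\<close> with states
  \<open>Q\<close>, and let \<open>u\<close> be the word derived so far. What \<open>u\<close> may still become under the automaton is
  captured by the map that sends an assignment \<open>\<tau>\<close> of transformations of \<open>Q\<close> to the letters to the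
  resulting transformation of \<open>u\<close>. There are finitely many such maps, and the one for \<open>h u\<close> is
  computed from the one for \<open>u\<close> by pulling \<open>\<tau>\<close> back along \<open>h\<close>. So the sequences of endomorphisms whose
  result lies in \<open>M\<close> form a regular language.\<close>
theorem EDT0L_Int_regular:
  assumes "EDT0L A L" and "regular_language A M"
  shows "EDT0L A (L \<inter> M)"
proof -
  obtain C :: "('a + nat) set" and H R c where A: "finite A" and C: "finite C" "Inl ` A \<subseteq> C" "c \<in> C"
    and H: "finite H" "\<forall>h\<in>H. free_monoid_endo C h" and R: "regular_language H R"
    and L: "L = {w \<in> lists A. \<exists>hs\<in>R. fold (\<lambda>h u. h u) hs [c] = map Inl w}"
    using assms(1) unfolding EDT0L_def by blast
  obtain Q1 :: "nat set" and \<delta>1 q1 F1 where Q1: "finite Q1" "q1 \<in> Q1" "\<forall>q\<in>Q1. \<forall>h\<in>H. \<delta>1 q h \<in> Q1"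
    and R_eq: "R = {hs \<in> lists H. foldl \<delta>1 q1 hs \<in> F1}"
    using R unfolding regular_language_def by blast
  obtain Q :: "nat set" and \<delta> q0 F where Q: "finite Q" "q0 \<in> Q" "\<forall>q\<in>Q. \<forall>s\<in>A. \<delta> q s \<in> Q"
    and M_eq: "M = {w \<in> lists A. foldl \<delta> q0 w \<in> F}"
    using assms(2) unfolding regular_language_def by blast
  define T where "T = (PiE C (\<lambda>_. PiE Q (\<lambda>_. Q)))"
  have "finite T" unfolding T_def by (intro finite_PiE C Q)
  have T_in: "\<tau> d q \<in> Q" if "\<tau> \<in> T" "d \<in> C" "q \<in> Q" for \<tau> d q
    using that unfolding T_def by (metis PiE_mem)
  have fold_in: "fold \<tau> u q \<in> Q" if "\<tau> \<in> T" "u \<in> lists C" "q \<in> Q" for \<tau> u q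
    using that(2,3) by (induction u arbitrary: q) (auto simp: T_in [OF that(1)])
  \<comment> \<open>A word in \<open>M\<close> contains only letters of \<open>A\<close>; on all others any transformation will do.\<close>
  define \<tau>0 where "\<tau>0 = (\<lambda>d\<in>C. \<lambda>q\<in>Q. case d of Inl a \<Rightarrow> if a \<in> A then \<delta> q a else q | Inr _ \<Rightarrow> q)"
  have \<tau>0: "\<tau>0 \<in> T" unfolding \<tau>0_def T_def using Q by (auto split: sum.splits)
  have fold_\<tau>0: "fold \<tau>0 (map Inl w) q = foldl \<delta> q w" if "w \<in> lists A" "q \<in> Q" for w q
    using that
  proof (induction w arbitrary: q)
    case (Cons a w)
    then have "\<tau>0 (Inl a) q = \<delta> q a" using C by (auto simp: \<tau>0_def)
    then show ?case using Cons Q by auto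
  qed auto
  define word where "word hs = fold (\<lambda>h u. h u) hs [c]" for hs :: "(('a + nat) list \<Rightarrow> ('a + nat) list) list"
  have word: "word hs \<in> lists C" if "hs \<in> lists H" for hs
    unfolding word_def by (rule fold_free_monoid_endo_lists) (use that H C in auto)
  define pull where "pull h \<tau> = (\<lambda>d\<in>C. \<lambda>q\<in>Q. fold \<tau> (h [d]) q)" for h and \<tau> :: "'a + nat \<Rightarrow> nat \<Rightarrow> nat"
  have pull: "pull h \<tau> \<in> T" "fold \<tau> (h u) q = fold (pull h \<tau>) u q"
    if h: "h \<in> H" and \<tau>: "\<tau> \<in> T" and u: "u \<in> lists C" and q: "q \<in> Q" for h \<tau> u q
  proof -
    have endo: "free_monoid_endo C h" using H h by blast
    have h_in: "h [d] \<in> lists C" if "d \<in> C" for d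
      using free_monoid_endo_lists [OF endo, of "[d]"] that by simp
    have "fold \<tau> (h [d]) q \<in> Q" if "d \<in> C" "q \<in> Q" for d q
      using fold_in [OF \<tau> h_in] that by blast
    then show "pull h \<tau> \<in> T" unfolding pull_def T_def by auto
    show "fold \<tau> (h u) q = fold (pull h \<tau>) u q" using u q
    proof (induction u arbitrary: q rule: list.induct)
      case Nil
      then show ?case using endo by (simp add: free_monoid_endo_def)
    next
      case (Cons d u)
      have "[d] \<in> lists C" "u \<in> lists C" "d \<in> C" using Cons.prems(1) by auto
      then have "h ([d] @ u) = h [d] @ h u"
        using endo unfolding free_monoid_endo_def by blast
      moreover have "fold \<tau> (h [d]) q \<in> Q" using fold_in [OF \<tau> h_in] \<open>d \<in> C\<close> Cons.prems by blast
      moreover have "pull h \<tau> d q = fold \<tau> (h [d]) q" using \<open>d \<in> C\<close> Cons.prems by (simp add: pull_def)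
      ultimately show ?case using Cons.IH [of "fold \<tau> (h [d]) q"] \<open>u \<in> lists C\<close> by simp
    qed
  qed
  define K where "K hs = (foldl \<delta>1 q1 hs, \<lambda>\<tau>\<in>T. \<lambda>q\<in>Q. fold \<tau> (word hs) q)" for hs
  define R' where "R' = {hs \<in> R. fold \<tau>0 (word hs) q0 \<in> F}"
  have "regular_language H R'"
  proof (rule regular_language_finite_index [where K = K])
    show "R' \<subseteq> lists H" unfolding R'_def R_eq by blast
    have "foldl \<delta>1 q hs \<in> Q1" if "hs \<in> lists H" "q \<in> Q1" for hs q
      using that by (induction hs arbitrary: q) (use Q1 in auto)
    then have "K ` lists H \<subseteq> Q1 \<times> PiE T (\<lambda>_. PiE Q (\<lambda>_. Q))"
      unfolding K_def using fold_in [OF _ word] Q1(2) by (force simp del: in_lists_conv_set)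
    moreover have "finite (Q1 \<times> PiE T (\<lambda>_. PiE Q (\<lambda>_. Q)))"
      by (intro finite_cartesian_product finite_PiE Q Q1 \<open>finite T\<close>)
    ultimately show "finite (K ` lists H)" by (rule finite_subset)
  next
    fix us vs h assume us: "us \<in> lists H" and vs: "vs \<in> lists H" and h: "h \<in> H" and K: "K us = K vs"
    have eq: "fold \<tau> (word us) q = fold \<tau> (word vs) q" if "\<tau> \<in> T" "q \<in> Q" for \<tau> q
      using K that unfolding K_def by (metis (no_types, lifting) Pair_inject restrict_apply')
    have "fold \<tau> (h (word us)) q = fold \<tau> (h (word vs)) q" if "\<tau> \<in> T" "q \<in> Q" for \<tau> q
      using pull(2) [OF h that(1) word [OF us] that(2)] pull(2) [OF h that(1) word [OF vs] that(2)]
        eq [OF pull(1) [OF h that(1) word [OF us] that(2)] that(2)] by simp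
    moreover have "word (us @ [h]) = h (word us)" "word (vs @ [h]) = h (word vs)"
      by (simp_all add: word_def)
    ultimately show "K (us @ [h]) = K (vs @ [h])"
      using K unfolding K_def by (auto simp: fun_eq_iff restrict_def)
  next
    fix us vs assume us: "us \<in> lists H" and vs: "vs \<in> lists H" and K: "K us = K vs" and R': "us \<in> R'"
    have "fold \<tau>0 (word us) q0 = fold \<tau>0 (word vs) q0"
      using K \<tau>0 Q unfolding K_def by (metis (no_types, lifting) Pair_inject restrict_apply')
    moreover have "foldl \<delta>1 q1 us = foldl \<delta>1 q1 vs" using K unfolding K_def by simp
    ultimately show "vs \<in> R'" using R' vs unfolding R'_def R_eq by auto
  qed
  moreover have "L \<inter> M = {w \<in> lists A. \<exists>hs\<in>R'. fold (\<lambda>h u. h u) hs [c] = map Inl w}"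
  proof -
    have "(\<exists>hs\<in>R. word hs = map Inl w) \<and> foldl \<delta> q0 w \<in> F \<longleftrightarrow> (\<exists>hs\<in>R'. word hs = map Inl w)"
      if "w \<in> lists A" for w
      using fold_\<tau>0 [OF that Q(2)] unfolding R'_def by (metis (mono_tags, lifting) mem_Collect_eq)
    then show ?thesis unfolding L M_eq word_def by blast
  qed
  ultimately show ?thesis
    unfolding EDT0L_def using A C H by blast
qed

section \<open>EDT0L languages as languages of register machines\<close>

definition eval_regs :: "('n \<Rightarrow> 'a list) \<Rightarrow> ('a + 'n) list \<Rightarrow> 'a list" where
  "eval_regs \<nu> u = concat (map (case_sum (\<lambda>a. [a]) \<nu>) u)"

lemma eval_regs_simps [simp]:
  "eval_regs \<nu> [] = []"
  "eval_regs \<nu> (Inl a # u) = a # eval_regs \<nu> u"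
  "eval_regs \<nu> (Inr n # u) = \<nu> n @ eval_regs \<nu> u"
  "eval_regs \<nu> (u @ v) = eval_regs \<nu> u @ eval_regs \<nu> v"
  "eval_regs \<nu> (map Inl w) = w"
  by (induction w) (auto simp: eval_regs_def)

text \<open>All registers are updated simultaneously from the old contents. The element \<open>\<eta>\<close> of \<open>\<Gamma>\<close> that
  describes an update also is an endomorphism that replaces the nonterminal \<open>n\<close> by \<open>\<eta> n\<close>.\<close>
inductive reachable :: "('n \<Rightarrow> ('a + 'n) list) set \<Rightarrow> ('n \<Rightarrow> 'a list) \<Rightarrow> ('n \<Rightarrow> 'a list) \<Rightarrow> bool"
  for \<Gamma> \<nu>0 where
  init: "reachable \<Gamma> \<nu>0 \<nu>0"
| step: "\<lbrakk>reachable \<Gamma> \<nu>0 \<nu>; \<eta> \<in> \<Gamma>\<rbrakk> \<Longrightarrow> reachable \<Gamma> \<nu>0 (\<lambda>n. eval_regs \<nu> (\<eta> n))"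

text \<open>The nonterminals are the registers, and a derivation uses the updates in reverse order; a further
  endomorphism replaces each register by its initial content. In the converse direction a derivation
  may use this endomorphism at any time, which only resets the machine;
  and it need not use it at all, but a terminal word does not change if the registers are replaced by
  their initial contents at the end.\<close>
theorem EDT0L_register_machine:
  fixes \<Gamma> :: "('n::finite \<Rightarrow> ('a::finite + 'n) list) set"
  assumes "finite \<Gamma>"
  shows "EDT0L UNIV {\<nu> n0 | \<nu>. reachable \<Gamma> \<nu>0 \<nu>}"
proof -
  define \<Delta> where "\<Delta> = insert (\<lambda>n. map Inl (\<nu>0 n)) \<Gamma>"
  define nt :: "'a + 'n \<Rightarrow> 'a + nat" where "nt = map_sum id to_nat"
  have nt_simps [simp]: "nt (Inl a) = Inl a" "nt (Inr n) = Inr (to_nat n)" for a n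
    by (simp_all add: nt_def)
  define h :: "('n \<Rightarrow> ('a + 'n) list) \<Rightarrow> ('a + nat) list \<Rightarrow> ('a + nat) list"
    where "h \<eta> = (\<lambda>u. concat (map (case_sum (\<lambda>a. [Inl a]) (\<lambda>k. map nt (\<eta> (from_nat k)))) u))" for \<eta>
  have h_simps [simp]: "h \<eta> [] = []" "h \<eta> (Inl a # u) = Inl a # h \<eta> u"
    "h \<eta> (Inr (to_nat n) # u) = map nt (\<eta> n) @ h \<eta> u"
    "h \<eta> (u @ v) = h \<eta> u @ h \<eta> v" for \<eta> a n u v
    by (simp_all add: h_def)
  define subst where "subst \<eta> u = concat (map (case_sum (\<lambda>a. [Inl a]) \<eta>) u)"
    for \<eta> :: "'n \<Rightarrow> ('a + 'n) list" and u
  have h_nt: "h \<eta> (map nt u) = map nt (subst \<eta> u)" for \<eta> u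
  proof (induction u)
    case (Cons d u)
    then show ?case by (cases d) (simp_all add: subst_def)
  qed (simp add: subst_def)
  define word where "word \<eta>s u = fold (\<lambda>h u. h u) (map h \<eta>s) (map nt u)" for \<eta>s u
  have eval_subst: "eval_regs \<nu> (subst \<eta> u) = eval_regs (\<lambda>n. eval_regs \<nu> (\<eta> n)) u" for \<nu> \<eta> u
  proof (induction u)
    case (Cons d u)
    then show ?case by (cases d) (simp_all add: subst_def)
  qed (simp add: subst_def)
  define val where "val \<eta>s = foldr (\<lambda>\<eta> \<nu> n. eval_regs \<nu> (\<eta> n)) \<eta>s \<nu>0" for \<eta>s
  \<comment> \<open>A derivation that ends in a terminal word yields what the machine computes from the reversed updates.\<close>
  have word_val: "w = eval_regs (val \<eta>s) u" if "word \<eta>s u = map Inl w" for \<eta>s u w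
    using that
  proof (induction \<eta>s arbitrary: u)
    case Nil
    have "u = map Inl w" using Nil by (induction u arbitrary: w)
        (auto simp: word_def Cons_eq_map_conv, (case_tac a; simp)+)
    then show ?case by (simp add: val_def)
  next
    case (Cons \<eta> \<eta>s)
    then have "word \<eta>s (subst \<eta> u) = map Inl w" by (simp add: word_def h_nt)
    from Cons.IH [OF this] show ?case by (simp add: val_def eval_subst)
  qed
  have val_reachable: "reachable \<Gamma> \<nu>0 (val \<eta>s)" if "set \<eta>s \<subseteq> \<Delta>" for \<eta>s
    using that by (induction \<eta>s)
      (auto simp: val_def \<Delta>_def intro: reachable.init reachable.step)
  have word_reset: "word [\<lambda>n. map Inl (\<nu>0 n)] u = map Inl (eval_regs \<nu>0 u)" for u
    by (induction u) (auto simp: word_def, (case_tac a; simp)+)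
  have reachable_word: "\<exists>\<eta>s. set \<eta>s \<subseteq> \<Delta> \<and> (\<forall>u. word \<eta>s u = map Inl (eval_regs \<nu> u))"
    if "reachable \<Gamma> \<nu>0 \<nu>" for \<nu>
    using that
  proof induction
    case init
    show ?case using word_reset by (intro exI [of _ "[\<lambda>n. map Inl (\<nu>0 n)]"]) (auto simp: \<Delta>_def)
  next
    case (step \<nu> \<eta>)
    then obtain \<eta>s where "set \<eta>s \<subseteq> \<Delta>" "\<forall>u. word \<eta>s u = map Inl (eval_regs \<nu> u)" by blast
    then show ?case using step.hyps
      by (intro exI [of _ "\<eta> # \<eta>s"]) (auto simp: \<Delta>_def word_def h_nt eval_subst)
  qed
  have "{\<nu> n0 | \<nu>. reachable \<Gamma> \<nu>0 \<nu>} =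
      {w \<in> lists UNIV. \<exists>hs\<in>lists (h ` \<Delta>). fold (\<lambda>h u. h u) hs [Inr (to_nat n0)] = map Inl w}"
    (is "?L = ?R")
  proof (intro Set.set_eqI iffI)
    fix w assume "w \<in> ?L"
    then obtain \<nu> where \<nu>: "reachable \<Gamma> \<nu>0 \<nu>" "w = \<nu> n0" by blast
    obtain \<eta>s where \<eta>s: "set \<eta>s \<subseteq> \<Delta>" "word \<eta>s [Inr n0] = map Inl (eval_regs \<nu> [Inr n0])"
      using reachable_word [OF \<nu>(1)] by blast
    from \<eta>s(2) have "fold (\<lambda>h u. h u) (map h \<eta>s) [Inr (to_nat n0)] = map Inl w"
      using \<nu> by (simp add: word_def)
    moreover have "map h \<eta>s \<in> lists (h ` \<Delta>)" using \<eta>s(1) by fastforce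
    ultimately show "w \<in> ?R" by blast
  next
    fix w assume "w \<in> ?R"
    then obtain hs where hs: "hs \<in> lists (h ` \<Delta>)" "fold (\<lambda>h u. h u) hs [Inr (to_nat n0)] = map Inl w"
      by blast
    from hs(1) obtain \<eta>s where \<eta>s: "hs = map h \<eta>s" "\<eta>s \<in> lists \<Delta>"
      unfolding lists_image by blast
    then have "word \<eta>s [Inr n0] = map Inl w" using hs(2) by (simp add: word_def)
    from word_val [OF this] have "w = val \<eta>s n0" by simp
    then show "w \<in> ?L" using val_reachable \<eta>s(2) by blast
  qed
  moreover have "free_monoid_endo (range nt) (h \<eta>)" for \<eta>
  proof -
    have "h \<eta> u \<in> lists (range nt)" if "u \<in> lists (range nt)" for u
      using that unfolding lists_image by (auto simp: h_nt)
    then show ?thesis unfolding free_monoid_endo_def by auto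
  qed
  moreover have "Inr (to_nat n0) \<in> range nt" using nt_simps(2) by (metis rangeI)
  moreover have "Inl a \<in> range nt" for a using nt_simps(1) by (metis rangeI)
  moreover have "finite (h ` \<Delta>)" using assms by (simp add: \<Delta>_def)
  ultimately show ?thesis
    unfolding EDT0L_def
    by (intro conjI exI [of _ "range nt"] exI [of _ "h ` \<Delta>"] exI [of _ "lists (h ` \<Delta>)"]
        exI [of _ "Inr (to_nat n0)"]) (auto intro: regular_language_lists)
qed

section \<open>Words and the free group\<close>

definition winv :: "'x letter list \<Rightarrow> 'x letter list" where
  "winv w = rev (map inv_letter w)"

lemma winv_simps [simp]:
  "winv [] = []" "winv (l # w) = winv w @ [inv_letter l]" "winv (u @ v) = winv v @ winv u"
  "winv (winv w) = w" "length (winv w) = length w" "winv w = [] \<longleftrightarrow> w = []"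
  by (simp_all add: winv_def rev_map comp_def)

lemma inv_letter_eq_iff: "inv_letter k = l \<longleftrightarrow> k = inv_letter l"
  by (metis inv_letter_inv_letter)

lemma inv_letter_neq [simp]: "inv_letter l \<noteq> l" "l \<noteq> inv_letter l"
  by (cases l; simp add: inv_letter_def)+

lemma reduced_append:
  "reduced (u @ v) \<longleftrightarrow> reduced u \<and> reduced v \<and> (u \<noteq> [] \<longrightarrow> v \<noteq> [] \<longrightarrow> hd v \<noteq> inv_letter (last u))"
  by (auto simp: reduced_def successively_append_iff)

lemma reduced_single [simp]: "reduced [l]"
  by (simp add: reduced_Cons)

lemma reduced_appendD: "reduced (u @ v) \<Longrightarrow> reduced u" "reduced (u @ v) \<Longrightarrow> reduced v"
  by (simp_all add: reduced_append)

lemma reduced_overlap: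
  "\<lbrakk>reduced (u @ v); reduced (v @ w); v \<noteq> []\<rbrakk> \<Longrightarrow> reduced (u @ v @ w)"
  by (auto simp: reduced_append)

lemma reduced_winv [simp]: "reduced (winv w) \<longleftrightarrow> reduced w"
proof -
  have *: "reduced (winv w)" if "reduced w" for w :: "'a letter list"
    using that by (induction w) (auto simp: reduced_Cons reduced_append last_rev hd_map winv_def inv_letter_eq_iff)
  show ?thesis using * [of w] * [of "winv w"] by auto
qed

lemma reduce_Nil [simp]: "reduce [] = []"
  by (simp add: reduce_def)

lemma reduce_winv_left: "reduce (winv w @ w) = []"
  unfolding winv_def by (rule reduce_inverse)

lemma reduce_winv_right: "reduce (w @ winv w) = []"
  using reduce_winv_left [of "winv w"] by simp

lemma reduce_append_cong:
  "\<lbrakk>reduce u = reduce u'; reduce v = reduce v'\<rbrakk> \<Longrightarrow> reduce (u @ v) = reduce (u' @ v')"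
  by (metis reduce_append_reduce reduce_reduce_append)

lemma reduce_winv_cong:
  assumes "reduce u = reduce v" shows "reduce (winv u) = reduce (winv v)"
proof -
  have "reduce (winv u) = reduce (winv u @ reduce (v @ winv v))"
    by (simp add: reduce_winv_right)
  also have "\<dots> = reduce ((winv u @ v) @ winv v)"
    by (simp add: reduce_append_reduce)
  also have "\<dots> = reduce (reduce (winv u @ reduce u) @ winv v)"
    using assms by (simp add: reduce_append_reduce reduce_reduce_append)
  also have "\<dots> = reduce (winv v)"
    by (simp add: reduce_append_reduce reduce_winv_left)
  finally show ?thesis .
qed

text \<open>The free group as a type of class \<open>group_add\<close>. Addition is not commutative here; the point is
  that identities such as those for conjugates are proved by rewriting, without carrier conditions.\<close>
quotient_type 'x fgroup = "'x letter list" / "\<lambda>u v. reduce u = reduce v"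
  morphisms rep_fgroup cls
  by (rule equivpI) (auto simp: reflp_def symp_def transp_def)

instantiation fgroup :: (type) group_add
begin

lift_definition zero_fgroup :: "'a fgroup" is "[]" .

lift_definition plus_fgroup :: "'a fgroup \<Rightarrow> 'a fgroup \<Rightarrow> 'a fgroup" is "(@)"
  by (rule reduce_append_cong)

lift_definition uminus_fgroup :: "'a fgroup \<Rightarrow> 'a fgroup" is winv
  by (rule reduce_winv_cong)

definition minus_fgroup :: "'a fgroup \<Rightarrow> 'a fgroup \<Rightarrow> 'a fgroup" where
  "minus_fgroup x y = x + - y"

instance
  by intro_classes (transfer; simp add: reduce_winv_left minus_fgroup_def)+

end

text \<open>The reduced word that represents an element.\<close>
lift_definition nf :: "'x fgroup \<Rightarrow> 'x letter list" is reduce .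

lemma cls_append: "cls (u @ v) = cls u + cls v"
  by (simp add: plus_fgroup.abs_eq)

lemma cls_winv: "cls (winv w) = - cls w"
  by (simp add: uminus_fgroup.abs_eq)

lemma cls_Nil: "cls [] = 0"
  by (simp add: zero_fgroup.abs_eq)

lemma cls_eq_iff: "cls u = cls v \<longleftrightarrow> reduce u = reduce v"
  by (rule fgroup.abs_eq_iff)

lemma nf_cls: "nf (cls w) = reduce w"
  by (rule nf.abs_eq)

lemma cls_reduce [simp]: "cls (reduce w) = cls w"
  by (simp add: cls_eq_iff reduce_reduced reduced_reduce)

lemma cls_nf [simp]: "cls (nf x) = x"
  by (induction x rule: fgroup.abs_induct) (simp add: nf_cls)

lemma reduced_nf [simp]: "reduced (nf x)"
  by (metis cls_nf nf_cls reduced_reduce)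

lemma nf_unique: "\<lbrakk>reduced w; cls w = x\<rbrakk> \<Longrightarrow> nf x = w"
  using nf_cls reduce_reduced by metis

lemma nf_add: "nf (x + y) = reduce (nf x @ nf y)"
  by (metis cls_append cls_nf nf_cls)

lemma nf_uminus: "nf (- x) = winv (nf x)"
  by (rule nf_unique) (simp_all add: cls_winv)

definition of_gen :: "'x \<Rightarrow> 'x fgroup" where
  "of_gen i = cls [(i, True)]"

text \<open>The value of a word when the generators take the values \<open>\<sigma>\<close>, in a group written additively.\<close>
definition word_sum :: "('x \<Rightarrow> 'g::group_add) \<Rightarrow> 'x letter list \<Rightarrow> 'g" where
  "word_sum \<sigma> w = sum_list (map (\<lambda>l. if snd l then \<sigma> (fst l) else - \<sigma> (fst l)) w)"

lemma word_sum_Nil [simp]: "word_sum \<sigma> [] = 0"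
  and word_sum_Cons: "word_sum \<sigma> (l # w) = (if snd l then \<sigma> (fst l) else - \<sigma> (fst l)) + word_sum \<sigma> w"
  and word_sum_append: "word_sum \<sigma> (u @ v) = word_sum \<sigma> u + word_sum \<sigma> v"
  by (simp_all add: word_sum_def)

lemma word_sum_reduce: "word_sum \<sigma> (reduce w) = word_sum \<sigma> w"
proof -
  have "word_sum \<sigma> (cons_reduce l u) = word_sum \<sigma> (l # u)" for l u
    by (cases u) (auto simp: cons_reduce_def word_sum_Cons inv_letter_def simp flip: add.assoc)
  then show ?thesis by (induction w) (simp_all add: reduce_def word_sum_Cons)
qed

lemma word_sum_of_gen: "word_sum of_gen w = cls w"
proof (induction w)
  case (Cons l w)
  have "(if snd l then of_gen (fst l) else - of_gen (fst l)) = cls [l]"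
    by (cases l) (auto simp: of_gen_def inv_letter_def simp flip: cls_winv)
  then show ?case using Cons by (simp add: word_sum_Cons flip: cls_append)
qed (simp add: cls_Nil)

text \<open>The homomorphism given by the universal property.\<close>
lift_definition hom_ext :: "('x \<Rightarrow> 'g::group_add) \<Rightarrow> 'x fgroup \<Rightarrow> 'g" is word_sum
  by (metis word_sum_reduce)

definition add_hom :: "('g::group_add \<Rightarrow> 'h::group_add) \<Rightarrow> bool" where
  "add_hom \<theta> \<longleftrightarrow> (\<forall>x y. \<theta> (x + y) = \<theta> x + \<theta> y)"

lemma add_hom_add: "add_hom \<theta> \<Longrightarrow> \<theta> (x + y) = \<theta> x + \<theta> y"
  by (simp add: add_hom_def)

lemma add_hom_0: "add_hom \<theta> \<Longrightarrow> \<theta> 0 = 0"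
  using add_hom_add [of \<theta> 0 0] add_right_cancel [of 0 "\<theta> 0" "\<theta> 0"] by simp

lemma add_hom_uminus: "add_hom \<theta> \<Longrightarrow> \<theta> (- x) = - \<theta> x"
  using add_hom_add [of \<theta> "- x" x] by (simp add: add_hom_0 eq_neg_iff_add_eq_0)

lemma add_hom_comp: "\<lbrakk>add_hom \<theta>; add_hom \<phi>\<rbrakk> \<Longrightarrow> add_hom (\<lambda>x. \<theta> (\<phi> x))"
  by (simp add: add_hom_def)

lemma add_hom_hom_ext: "add_hom (hom_ext \<sigma>)"
  unfolding add_hom_def by (transfer, simp add: word_sum_append)

lemma hom_ext_of_gen [simp]: "hom_ext \<sigma> (of_gen i) = \<sigma> i"
  unfolding of_gen_def by (simp add: hom_ext.abs_eq word_sum_Cons)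

lemma add_hom_word_sum:
  assumes "add_hom \<theta>" shows "\<theta> (word_sum \<sigma> w) = word_sum (\<lambda>i. \<theta> (\<sigma> i)) w"
  by (induction w) (simp_all add: word_sum_Cons add_hom_0 add_hom_add add_hom_uminus assms)

lemma word_sum_cong: "(\<And>i. i \<in> fst ` set w \<Longrightarrow> \<sigma> i = \<tau> i) \<Longrightarrow> word_sum \<sigma> w = word_sum \<tau> w"
  by (induction w) (auto simp: word_sum_Cons)

inductive_set subgroup_span :: "'g::group_add set \<Rightarrow> 'g set" for S where
  zero: "0 \<in> subgroup_span S"
| base: "x \<in> S \<Longrightarrow> x \<in> subgroup_span S"
| add: "\<lbrakk>x \<in> subgroup_span S; y \<in> subgroup_span S\<rbrakk> \<Longrightarrow> x + y \<in> subgroup_span S"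
| uminus: "x \<in> subgroup_span S \<Longrightarrow> - x \<in> subgroup_span S"

lemma subgroup_span_trans:
  assumes "S \<subseteq> subgroup_span T" shows "subgroup_span S \<subseteq> subgroup_span T"
proof
  fix x assume "x \<in> subgroup_span S"
  then show "x \<in> subgroup_span T"
    by induction (use assms in \<open>auto intro: subgroup_span.intros\<close>)
qed

lemma subgroup_span_minus:
  "\<lbrakk>x \<in> subgroup_span S; y \<in> subgroup_span S\<rbrakk> \<Longrightarrow> x - y \<in> subgroup_span S"
  using subgroup_span.add [OF _ subgroup_span.uminus] by fastforce

text \<open>Rewriting with these equations, and without turning \<open>a + - b\<close> back into \<open>a - b\<close>, brings group terms
  into a normal form in which cancelling neighbours are removed by the simplifier.\<close>
lemmas group_simps = diff_conv_add_uminus add.assoc minus_add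

lemma subgroup_span_conj:
  assumes "z \<in> subgroup_span S" shows "g + z - g \<in> subgroup_span ((\<lambda>x. g + x - g) ` S)"
  using assms
proof induction
  case (add x y)
  have "g + (x + y) - g = (g + x - g) + (g + y - g)" by (simp add: group_simps del: add_uminus_conv_diff)
  then show ?case using subgroup_span.add [OF add.IH] by simp
next
  case (uminus x)
  have "g + - x - g = - (g + x - g)" by (simp add: group_simps del: add_uminus_conv_diff)
  then show ?case using subgroup_span.uminus [OF uminus.IH] by simp
qed (auto intro: subgroup_span.intros)

lemma word_sum_in_subgroup_span: "\<sigma> ` fst ` set w \<subseteq> S \<Longrightarrow> word_sum \<sigma> w \<in> subgroup_span S"
  by (induction w) (auto simp: word_sum_Cons intro: subgroup_span.intros)

lemma subgroup_span_word_sum: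
  assumes "x \<in> subgroup_span (\<sigma> ` I)"
  obtains w where "reduced w" "fst ` set w \<subseteq> I" "word_sum \<sigma> w = x"
proof -
  have "\<exists>w. fst ` set w \<subseteq> I \<and> word_sum \<sigma> w = x"
    using assms
  proof induction
    case zero
    show ?case by (intro exI [of _ "[]"]) simp
  next
    case (base x)
    then obtain i where "i \<in> I" "\<sigma> i = x" by blast
    then show ?case by (intro exI [of _ "[(i, True)]"]) (simp add: word_sum_Cons)
  next
    case (add x y)
    then obtain u v where "fst ` set u \<subseteq> I" "word_sum \<sigma> u = x"
      "fst ` set v \<subseteq> I" "word_sum \<sigma> v = y" by blast
    then show ?case by (intro exI [of _ "u @ v"]) (auto simp: word_sum_append)
  next
    case (uminus x)
    then obtain u where u: "fst ` set u \<subseteq> I" "word_sum \<sigma> u = x" by blast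
    have "word_sum \<sigma> (winv u) = - word_sum \<sigma> u"
      by (induction u) (auto simp: word_sum_append word_sum_Cons inv_letter_def minus_add)
    moreover have "fst ` set (winv u) = fst ` set u"
      by (auto simp: winv_def inv_letter_def image_comp)
    ultimately show ?case using u by (intro exI [of _ "winv u"]) auto
  qed
  then obtain w where "fst ` set w \<subseteq> I" "word_sum \<sigma> w = x" by blast
  then show ?thesis using that [of "reduce w"] set_reduce [of w]
    by (fastforce simp: reduced_reduce word_sum_reduce)
qed

lemma span_gens: "subgroup_span (range of_gen) = UNIV"
proof -
  have "cls w \<in> subgroup_span (range of_gen)" for w :: "'a letter list"
    unfolding word_sum_of_gen [symmetric] by (rule word_sum_in_subgroup_span) auto
  then show ?thesis by (metis UNIV_eq_I cls_nf)
qed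

section \<open>Free generation\<close>

text \<open>A homomorphism \<open>\<theta>\<close> to the free group on the indices that sends \<open>gs ! i\<close> to the generator \<open>i\<close> shows
  that there is no relation between the elements of \<open>gs\<close>: it is inverse to the evaluation of words
  at \<open>gs\<close>. In this form freeness carries over to other tuples by composing \<open>\<theta>\<close> with homomorphisms.\<close>
definition freely_generates :: "'g::group_add list \<Rightarrow> bool" where
  "freely_generates gs \<longleftrightarrow> subgroup_span (set gs) = UNIV \<and>
     (\<exists>\<theta> :: 'g \<Rightarrow> nat fgroup. add_hom \<theta> \<and> (\<forall>i<length gs. \<theta> (gs ! i) = of_gen i))"

lemma UNIV_gen: "UNIV = {Gen_a, Gen_b}"
  using gen.exhaust by auto

instance gen :: finite
  by intro_classes (simp add: UNIV_gen)

lemma carrier_F2: "carrier F2 = {w. reduced w}"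
  by (auto simp: free_group_def intro: gen.exhaust)

lemma mult_F2: "u \<otimes>\<^bsub>F2\<^esub> v = reduce (u @ v)"
  by (simp add: free_group_def)

lemma one_F2: "\<one>\<^bsub>F2\<^esub> = []"
  by (simp add: free_group_def)

lemma cls_inv_F2:
  assumes "reduced w" shows "cls (inv\<^bsub>F2\<^esub> w) = - cls w"
proof -
  have "inv\<^bsub>F2\<^esub> w \<otimes>\<^bsub>F2\<^esub> w = \<one>\<^bsub>F2\<^esub>"
    using assms by (intro group.l_inv group_free_group) (simp add: carrier_F2)
  then have "reduce (inv\<^bsub>F2\<^esub> w @ w) = []" by (simp add: mult_F2 one_F2)
  then have "cls (inv\<^bsub>F2\<^esub> w @ w) = 0" by (metis cls_Nil cls_reduce)
  then show ?thesis by (simp add: cls_append eq_neg_iff_add_eq_0)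
qed

lemma word_eval_F2:
  assumes "\<And>i. i \<in> fst ` set s \<Longrightarrow> reduced (f i)"
  shows "reduced (word_eval F2 f s)" "cls (word_eval F2 f s) = word_sum (\<lambda>i. cls (f i)) s"
  using assms
  by (induction s) (auto simp: word_eval_def one_F2 mult_F2 reduced_reduce cls_Nil cls_append word_sum_Cons cls_inv_F2)

text \<open>If evaluation at \<open>gs\<close> is an isomorphism, then \<open>\<theta>\<close> is its inverse. Conversely, \<open>\<theta>\<close> forces evaluation to
  be injective, and it is surjective because \<open>gs\<close> generates.\<close>
theorem free_basis_F2_iff:
  "free_basis F2 gs \<longleftrightarrow> set gs \<subseteq> carrier F2 \<and> freely_generates (map cls gs)"
proof (cases "set gs \<subseteq> carrier F2")
  case gs: True
  let ?n = "length gs" and ?\<Phi> = "word_eval F2 (\<lambda>i. gs ! i)" and ?\<sigma> = "\<lambda>i. cls (gs ! i)"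
  let ?D = "carrier (free_group {..<?n})"
  have D: "?D = {s. reduced s \<and> fst ` set s \<subseteq> {..<?n}}" by (simp add: free_group_def)
  have gs': "reduced (gs ! i)" if "i < ?n" for i
    using gs that nth_mem by (fastforce simp: carrier_F2)
  have \<Phi>: "reduced (?\<Phi> s)" "cls (?\<Phi> s) = word_sum ?\<sigma> s" if "fst ` set s \<subseteq> {..<?n}" for s
    using word_eval_F2 [of s "\<lambda>i. gs ! i"] gs' that by auto
  have gen_D: "[(i, True)] \<in> ?D" if "i < ?n" for i
    using that by (simp add: D reduced_Cons)
  have hom: "?\<Phi> \<in> hom (free_group {..<?n}) F2"
  proof (rule homI)
    fix s assume "s \<in> ?D"
    then show "?\<Phi> s \<in> carrier F2" using \<Phi>(1) by (simp add: D carrier_F2)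
  next
    fix s t assume st: "s \<in> ?D" "t \<in> ?D"
    have mult: "s \<otimes>\<^bsub>free_group {..<?n}\<^esub> t = reduce (s @ t)" by (simp add: free_group_def)
    have sub: "fst ` set (reduce (s @ t)) \<subseteq> {..<?n}"
      using set_reduce [of "s @ t"] st by (fastforce simp: D)
    have "cls (?\<Phi> (reduce (s @ t))) = cls (?\<Phi> s \<otimes>\<^bsub>F2\<^esub> ?\<Phi> t)"
      using sub st by (simp add: \<Phi> D mult_F2 cls_append word_sum_append word_sum_reduce)
    then show "?\<Phi> (s \<otimes>\<^bsub>free_group {..<?n}\<^esub> t) = ?\<Phi> s \<otimes>\<^bsub>F2\<^esub> ?\<Phi> t"
      using \<Phi>(1) [OF sub] unfolding mult by (simp add: mult_F2 cls_eq_iff reduce_reduced reduced_reduce)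
  qed
  have "bij_betw ?\<Phi> ?D (carrier F2) \<longleftrightarrow> freely_generates (map cls gs)"
  proof
    assume bij: "bij_betw ?\<Phi> ?D (carrier F2)"
    define \<psi> where "\<psi> x = the_inv_into ?D ?\<Phi> (nf x)" for x
    have \<psi>: "\<psi> x \<in> ?D" "?\<Phi> (\<psi> x) = nf x" for x
      using bij the_inv_into_into [of ?\<Phi> ?D "nf x" ?D] f_the_inv_into_f_bij_betw [OF bij, of "nf x"]
      unfolding \<psi>_def bij_betw_def by (simp_all add: carrier_F2)
    have \<psi>_eq: "\<psi> (cls (?\<Phi> s)) = s" if "s \<in> ?D" for s
    proof -
      have "?\<Phi> (\<psi> (cls (?\<Phi> s))) = ?\<Phi> s"
        using \<psi>(2) \<Phi>(1) that by (simp add: D nf_cls reduce_reduced)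
      then show ?thesis using bij \<psi>(1) that by (auto simp: bij_betw_def dest: inj_onD)
    qed
    have "add_hom (\<lambda>x. cls (\<psi> x))"
      unfolding add_hom_def
    proof (intro allI)
      fix x y
      let ?s = "\<psi> x \<otimes>\<^bsub>free_group {..<?n}\<^esub> \<psi> y"
      have s: "?s \<in> ?D"
        using group.is_monoid [OF group_free_group] \<psi>(1) by (meson monoid.m_closed)
      have "?\<Phi> ?s = nf (x + y)"
        using hom \<psi> by (simp add: hom_def mult_F2 nf_add)
      then have "\<psi> (x + y) = ?s" using \<psi>_eq [OF s] by simp
      then show "cls (\<psi> (x + y)) = cls (\<psi> x) + cls (\<psi> y)"
        by (simp add: free_group_def cls_append)
    qed
    moreover have "cls (\<psi> (cls (gs ! i))) = of_gen i" if "i < ?n" for i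
    proof -
      have "cls (gs ! i) = cls (?\<Phi> [(i, True)])" using \<Phi>(2) [of "[(i, True)]"] that by (simp add: word_sum_Cons)
      then show ?thesis using \<psi>_eq [OF gen_D [OF that]] by (simp add: of_gen_def)
    qed
    moreover have "x \<in> subgroup_span (set (map cls gs))" for x
    proof -
      have "x = cls (?\<Phi> (\<psi> x))" by (simp add: \<psi>(2))
      also have "\<dots> = word_sum ?\<sigma> (\<psi> x)" using \<Phi>(2) \<psi>(1) [of x] by (simp add: D)
      also have "\<dots> \<in> subgroup_span (set (map cls gs))"
        using \<psi>(1) [of x] by (intro word_sum_in_subgroup_span) (auto simp: D)
      finally show ?thesis .
    qed
    ultimately show "freely_generates (map cls gs)"
      unfolding freely_generates_def by (intro conjI exI [of _ "\<lambda>x. cls (\<psi> x)"]) auto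
  next
    assume "freely_generates (map cls gs)"
    then obtain \<theta> :: "gen fgroup \<Rightarrow> nat fgroup" where span: "subgroup_span (set (map cls gs)) = UNIV"
      and \<theta>: "add_hom \<theta>" "\<And>i. i < ?n \<Longrightarrow> \<theta> (cls (gs ! i)) = of_gen i"
      unfolding freely_generates_def by auto
    have \<theta>_word_sum: "\<theta> (word_sum ?\<sigma> s) = cls s" if "fst ` set s \<subseteq> {..<?n}" for s
    proof -
      have "word_sum (\<lambda>i. \<theta> (cls (gs ! i))) s = word_sum of_gen s"
        by (rule word_sum_cong) (use that \<theta>(2) in blast)
      then show ?thesis by (simp add: add_hom_word_sum [OF \<theta>(1)] word_sum_of_gen)
    qed
    show "bij_betw ?\<Phi> ?D (carrier F2)"
      unfolding bij_betw_def
    proof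
      show "inj_on ?\<Phi> ?D"
      proof (rule inj_onI)
        fix s t assume st: "s \<in> ?D" "t \<in> ?D" "?\<Phi> s = ?\<Phi> t"
        then have "cls s = cls t" using \<theta>_word_sum \<Phi>(2) by (metis (no_types, lifting) D mem_Collect_eq)
        then show "s = t" using st by (simp add: D cls_eq_iff reduce_reduced)
      qed
      have "w \<in> ?\<Phi> ` ?D" if w: "reduced w" for w
      proof -
        have "set gs = (\<lambda>i. gs ! i) ` {..<?n}" by (auto simp: in_set_conv_nth)
        then have "set (map cls gs) = ?\<sigma> ` {..<?n}" by (simp add: image_comp comp_def)
        then have "cls w \<in> subgroup_span (?\<sigma> ` {..<?n})" using span by simp
        then obtain s where s: "reduced s" "fst ` set s \<subseteq> {..<?n}" "word_sum ?\<sigma> s = cls w"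
          by (rule subgroup_span_word_sum)
        then have "cls (?\<Phi> s) = cls w" using s \<Phi>(2) by simp
        then have "?\<Phi> s = w" using \<Phi>(1) [OF s(2)] w by (simp add: cls_eq_iff reduce_reduced)
        then show ?thesis using s by (auto simp: D)
      qed
      then show "?\<Phi> ` ?D = carrier F2" using \<Phi>(1) by (auto simp: carrier_F2 D)
    qed
  qed
  then show ?thesis using gs hom by (simp add: free_basis_def iso_def)
qed (simp add: free_basis_def)

lemma add_hom_eq_on_span:
  assumes "add_hom \<theta>" "add_hom \<phi>" "\<And>x. x \<in> S \<Longrightarrow> \<theta> x = \<phi> x" "x \<in> subgroup_span S"
  shows "\<theta> x = \<phi> x"
  using assms(4) by induction (simp_all add: assms add_hom_0 add_hom_add add_hom_uminus)

text \<open>Homomorphisms from \<open>F\<^sub>2\<close> to the group with two elements are determined by the values on \<open>a\<close> and \<open>b\<close>,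
  which can be arbitrary, but just as well by the values on a basis. Counting them in both ways gives
  \<open>2\<^sup>2 = 2\<^sup>n\<close> for a basis of length \<open>n\<close>.\<close>
lemma freely_generates_F2_length:
  fixes gs :: "gen fgroup list"
  assumes "freely_generates gs"
  shows "length gs = 2"
proof -
  let ?n = "length gs"
  obtain \<theta> :: "gen fgroup \<Rightarrow> nat fgroup" where span: "subgroup_span (set gs) = UNIV"
    and \<theta>: "add_hom \<theta>" "\<And>i. i < ?n \<Longrightarrow> \<theta> (gs ! i) = of_gen i"
    using assms unfolding freely_generates_def by auto
  let ?\<Psi> = "\<lambda>k :: gen \<Rightarrow> bit. \<lambda>i\<in>{..<?n}. hom_ext k (gs ! i)"
  have bij: "bij_betw ?\<Psi> UNIV (PiE {..<?n} (\<lambda>_. UNIV))"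
    unfolding bij_betw_def
  proof
    show "inj ?\<Psi>"
    proof (rule injI)
      fix k l assume eq: "?\<Psi> k = ?\<Psi> l"
      have "hom_ext k x = hom_ext l x" if "x \<in> set gs" for x
      proof -
        obtain i where "i < ?n" "x = gs ! i" using \<open>x \<in> set gs\<close> unfolding in_set_conv_nth by blast
        then show ?thesis using fun_cong [OF eq, of i] by simp
      qed
      then have "hom_ext k x = hom_ext l x" for x
        using add_hom_eq_on_span [OF add_hom_hom_ext [of k] add_hom_hom_ext [of l]] span by blast
      from this [of "of_gen c" for c] show "k = l" by (simp add: fun_eq_iff)
    qed
    have "m \<in> range ?\<Psi>" if m: "m \<in> PiE {..<?n} (\<lambda>_. UNIV)" for m
    proof -
      define \<chi> where "\<chi> x = hom_ext m (\<theta> x)" for x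
      have \<chi>: "add_hom \<chi>"
        unfolding \<chi>_def by (rule add_hom_comp [OF add_hom_hom_ext \<theta>(1)])
      have "hom_ext (\<lambda>c. \<chi> (of_gen c)) x = \<chi> x" for x
        by (rule add_hom_eq_on_span [OF add_hom_hom_ext [of "\<lambda>c. \<chi> (of_gen c)"] \<chi>, of "range of_gen" x])
          (auto simp: span_gens)
      then have "hom_ext (\<lambda>c. \<chi> (of_gen c)) (gs ! i) = m i" if "i < ?n" for i
        by (simp add: \<chi>_def \<theta>(2) that)
      then have "m = ?\<Psi> (\<lambda>c. \<chi> (of_gen c))"
        using m by (intro extensionalityI [of _ "{..<?n}"]) (simp_all add: PiE_iff)
      then show ?thesis by (intro image_eqI [of _ _ "\<lambda>c. \<chi> (of_gen c)"]) simp_all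
    qed
    moreover have "?\<Psi> k \<in> PiE {..<?n} (\<lambda>_. UNIV)" for k by simp
    ultimately show "range ?\<Psi> = PiE {..<?n} (\<lambda>_. UNIV)" by blast
  qed
  have card_bit: "card (UNIV :: bit set) = 2"
  proof -
    have "(UNIV :: bit set) = {0, 1}" using bit_not_zero_iff by blast
    then have "card (UNIV :: bit set) = card {0, 1 :: bit}" by (rule arg_cong)
    then show ?thesis by simp
  qed
  have "card (UNIV :: (gen \<Rightarrow> bit) set) = card (PiE {..<?n} (\<lambda>_. UNIV :: bit set))"
    using bij by (rule bij_betw_same_card)
  also have "\<dots> = 2 ^ ?n" by (simp add: card_PiE card_bit)
  also have "card (UNIV :: (gen \<Rightarrow> bit) set) = 2 ^ 2"
  proof -
    have "(UNIV :: (gen \<Rightarrow> bit) set) = PiE UNIV (\<lambda>_. UNIV)" by simp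
    then show ?thesis using card_PiE [of "UNIV :: gen set" "\<lambda>_. UNIV :: bit set"]
      by (simp add: UNIV_gen card_bit)
  qed
  finally show ?thesis using power_inject_exp [of "2 :: nat" 2 ?n] by simp
qed

lemma freely_generates_pair:
  "freely_generates [x, y] \<longleftrightarrow> subgroup_span {x, y} = UNIV \<and>
     (\<exists>\<theta> :: _ \<Rightarrow> nat fgroup. add_hom \<theta> \<and> \<theta> x = of_gen 0 \<and> \<theta> y = of_gen 1)"
  by (auto simp: freely_generates_def less_Suc_eq)

lemma span_pair_change:
  assumes "subgroup_span {x, y} = UNIV" "x \<in> subgroup_span {x', y'}" "y \<in> subgroup_span {x', y'}"
  shows "subgroup_span {x', y'} = UNIV"
  using subgroup_span_trans [of "{x, y}" "{x', y'}"] assms by auto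

lemma span_pair_swap: "subgroup_span {x, y} = UNIV \<Longrightarrow> subgroup_span {y, x} = UNIV"
  by (simp add: insert_commute)

lemma span_pair_uminus:
  assumes "subgroup_span {x, y} = UNIV" shows "subgroup_span {- x, y} = UNIV"
proof (rule span_pair_change [OF assms])
  show "x \<in> subgroup_span {- x, y}"
    using subgroup_span.uminus [OF subgroup_span.base [of "- x" "{- x, y}"]] by simp
qed (simp add: subgroup_span.base)

lemma span_pair_add:
  assumes "subgroup_span {x, y} = UNIV" shows "subgroup_span {x + y, y} = UNIV"
proof (rule span_pair_change [OF assms])
  show "x \<in> subgroup_span {x + y, y}"
    using subgroup_span_minus [OF subgroup_span.base subgroup_span.base, of "x + y" "{x + y, y}" y] by simp
qed (simp add: subgroup_span.base)

lemma span_pair_conj: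
  assumes "subgroup_span {x, y} = UNIV" shows "subgroup_span {g + x - g, g + y - g} = UNIV"
proof -
  have "z \<in> subgroup_span {g + x - g, g + y - g}" for z
    using subgroup_span_conj [of "- g + z + g" "{x, y}" g] assms by (simp add: group_simps del: add_uminus_conv_diff)
  then show ?thesis by blast
qed

text \<open>In this and the next lemmas \<open>\<rho>\<close> undoes the change of the basis on the free group on the indices.\<close>
lemma freely_generates_swap:
  assumes "freely_generates [x, y]" shows "freely_generates [y, x]"
proof -
  obtain \<theta> :: "_ \<Rightarrow> nat fgroup" where \<theta>: "add_hom \<theta>" "\<theta> x = of_gen 0" "\<theta> y = of_gen 1"
    and span: "subgroup_span {x, y} = UNIV"
    using assms unfolding freely_generates_pair by blast
  define \<rho> :: "nat fgroup \<Rightarrow> nat fgroup" where "\<rho> = hom_ext (\<lambda>i. of_gen (1 - i))"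
  have "add_hom (\<lambda>x. \<rho> (\<theta> x))" unfolding \<rho>_def by (rule add_hom_comp [OF add_hom_hom_ext \<theta>(1)])
  then show ?thesis
    unfolding freely_generates_pair using span_pair_swap [OF span] \<theta>
    by (intro conjI exI [of _ "\<lambda>x. \<rho> (\<theta> x)"]) (simp_all add: \<rho>_def)
qed

lemma freely_generates_uminus:
  assumes "freely_generates [x, y]" shows "freely_generates [- x, y]"
proof -
  obtain \<theta> :: "_ \<Rightarrow> nat fgroup" where \<theta>: "add_hom \<theta>" "\<theta> x = of_gen 0" "\<theta> y = of_gen 1"
    and span: "subgroup_span {x, y} = UNIV"
    using assms unfolding freely_generates_pair by blast
  define \<rho> :: "nat fgroup \<Rightarrow> nat fgroup" where "\<rho> = hom_ext (\<lambda>i. if i = 0 then - of_gen 0 else of_gen i)"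
  have "add_hom (\<lambda>x. \<rho> (\<theta> x))" unfolding \<rho>_def by (rule add_hom_comp [OF add_hom_hom_ext \<theta>(1)])
  then show ?thesis
    unfolding freely_generates_pair using span_pair_uminus [OF span] \<theta>
    by (intro conjI exI [of _ "\<lambda>x. \<rho> (\<theta> x)"])
      (simp_all add: \<rho>_def add_hom_uminus add_hom_hom_ext)
qed

lemma freely_generates_add:
  assumes "freely_generates [x, y]" shows "freely_generates [x + y, y]"
proof -
  obtain \<theta> :: "_ \<Rightarrow> nat fgroup" where \<theta>: "add_hom \<theta>" "\<theta> x = of_gen 0" "\<theta> y = of_gen 1"
    and span: "subgroup_span {x, y} = UNIV"
    using assms unfolding freely_generates_pair by blast
  define \<rho> :: "nat fgroup \<Rightarrow> nat fgroup" where "\<rho> = hom_ext (\<lambda>i. if i = 0 then of_gen 0 - of_gen 1 else of_gen i)"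
  have "add_hom (\<lambda>x. \<rho> (\<theta> x))" unfolding \<rho>_def by (rule add_hom_comp [OF add_hom_hom_ext \<theta>(1)])
  then show ?thesis
    unfolding freely_generates_pair using span_pair_add [OF span] \<theta>
    by (intro conjI exI [of _ "\<lambda>x. \<rho> (\<theta> x)"])
      (simp_all add: \<rho>_def add_hom_add add_hom_hom_ext)
qed

lemma freely_generates_conj:
  assumes "freely_generates [x, y]" shows "freely_generates [g + x - g, g + y - g]"
proof -
  obtain \<theta> :: "_ \<Rightarrow> nat fgroup" where \<theta>: "add_hom \<theta>" "\<theta> x = of_gen 0" "\<theta> y = of_gen 1"
    and span: "subgroup_span {x, y} = UNIV"
    using assms unfolding freely_generates_pair by blast
  have "add_hom (\<lambda>x. \<theta> (- g + x + g))"
    unfolding add_hom_def by (simp add: \<theta> group_simps del: add_uminus_conv_diff flip: add_hom_add)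
  then show ?thesis
    unfolding freely_generates_pair using span_pair_conj [OF span] \<theta>
    by (intro conjI exI [of _ "\<lambda>x. \<theta> (- g + x + g)"]) (simp_all add: group_simps del: add_uminus_conv_diff)
qed

lemma freely_generates_gens: "freely_generates [of_gen Gen_a, of_gen Gen_b]"
proof -
  have "range of_gen = {of_gen Gen_a, of_gen Gen_b}" by (simp add: UNIV_gen)
  then have "subgroup_span {of_gen Gen_a, of_gen Gen_b} = UNIV" using span_gens by metis
  then show ?thesis
    unfolding freely_generates_pair
    by (intro conjI exI [of _ "hom_ext (\<lambda>c. of_gen (case c of Gen_a \<Rightarrow> 0 | Gen_b \<Rightarrow> 1))"])
      (simp_all add: add_hom_hom_ext)
qed

section \<open>Positive bases\<close>

fun other :: "gen \<Rightarrow> gen" where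
  "other Gen_a = Gen_b"
| "other Gen_b = Gen_a"

text \<open>The substitution that replaces the generator \<open>c\<close> by \<open>d c\<close>, where \<open>d\<close> is the other generator; the
  variant \<open>expand_post\<close> below replaces it by \<open>c d\<close>.\<close>
definition expand_pre :: "gen \<Rightarrow> gen list \<Rightarrow> gen list" where
  "expand_pre c w = concat (map (\<lambda>z. if z = c then [other c, c] else [z]) w)"

definition expand_post :: "gen \<Rightarrow> gen list \<Rightarrow> gen list" where
  "expand_post c w = concat (map (\<lambda>z. if z = c then [c, other c] else [z]) w)"

lemma expand_append [simp]:
  "expand_pre c (u @ v) = expand_pre c u @ expand_pre c v"
  "expand_post c (u @ v) = expand_post c u @ expand_post c v"
  by (simp_all add: expand_pre_def expand_post_def)

lemma expand_Cons:
  "expand_pre c (z # v) = (if z = c then [other c, c] else [z]) @ expand_pre c v"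
  "expand_post c (z # v) = (if z = c then [c, other c] else [z]) @ expand_post c v"
  by (simp_all add: expand_pre_def expand_post_def)

lemma expand_Nil [simp]: "expand_pre c [] = []" "expand_post c [] = []"
  by (simp_all add: expand_pre_def expand_post_def)

lemma expand_eq_Nil [simp]: "expand_pre c w = [] \<longleftrightarrow> w = []" "expand_post c w = [] \<longleftrightarrow> w = []"
  by (cases w; simp add: expand_Cons)+

lemma other_cases: "z = c \<or> z = other c"
  by (cases z; cases c) auto

lemma other_neq [simp]: "other c \<noteq> c" "c \<noteq> other c"
  by (cases c; simp)+

text \<open>The two substitutions differ by conjugation with the other generator.\<close>
lemma expand_post_pre: "other c # expand_post c w = expand_pre c w @ [other c]"
proof (induction w)
  case (Cons z w)
  then show ?case using other_cases [of z c] by (auto simp: expand_Cons)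
qed simp

text \<open>Images of \<open>(a, b)\<close> under compositions of positive automorphisms. The rules change the pair at the inside of
  a composition \<open>\<phi>\<^sub>1 \<circ> \<dots> \<circ> \<phi>\<^sub>m\<close>, that is, they extend it by a further \<open>\<phi>\<^sub>m\<^sub>+\<^sub>1\<close>; the machine computes in
  this way.\<close>
inductive positive_basis :: "gen list \<Rightarrow> gen list \<Rightarrow> bool" where
  gens: "positive_basis [Gen_a] [Gen_b]"
| swap: "positive_basis u v \<Longrightarrow> positive_basis v u"
| append: "positive_basis u v \<Longrightarrow> positive_basis (u @ v) v"
| prepend: "positive_basis u v \<Longrightarrow> positive_basis (v @ u) v"

text \<open>The same pairs, but composed at the outside: the rules apply one more substitution to both
  words. This is the form for which rotations can be traced letter by letter.\<close>
inductive expanded_basis :: "gen list \<Rightarrow> gen list \<Rightarrow> bool" where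
  ab: "expanded_basis [Gen_a] [Gen_b]"
| ba: "expanded_basis [Gen_b] [Gen_a]"
| pre: "expanded_basis u v \<Longrightarrow> expanded_basis (expand_pre c u) (expand_pre c v)"
| post: "expanded_basis u v \<Longrightarrow> expanded_basis (expand_post c u) (expand_post c v)"

lemma expanded_basis_swap: "expanded_basis u v \<Longrightarrow> expanded_basis v u"
  by (induction rule: expanded_basis.induct) (auto intro: expanded_basis.intros)

lemma expanded_basis_append: "expanded_basis u v \<Longrightarrow> expanded_basis (u @ v) v"
proof (induction rule: expanded_basis.induct)
  case ab
  show ?case using expanded_basis.post [OF expanded_basis.ab, of Gen_a] by (simp add: expand_Cons)
next
  case ba
  show ?case using expanded_basis.post [OF expanded_basis.ba, of Gen_b] by (simp add: expand_Cons)
next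
  case (pre u v c)
  then show ?case using expanded_basis.pre [of "u @ v" v c] by simp
next
  case (post u v c)
  then show ?case using expanded_basis.post [of "u @ v" v c] by simp
qed

lemma expanded_basis_prepend: "expanded_basis u v \<Longrightarrow> expanded_basis (v @ u) v"
proof (induction rule: expanded_basis.induct)
  case ab
  show ?case using expanded_basis.pre [OF expanded_basis.ab, of Gen_a] by (simp add: expand_Cons)
next
  case ba
  show ?case using expanded_basis.pre [OF expanded_basis.ba, of Gen_b] by (simp add: expand_Cons)
next
  case (pre u v c)
  then show ?case using expanded_basis.pre [of "v @ u" v c] by simp
next
  case (post u v c)
  then show ?case using expanded_basis.post [of "v @ u" v c] by simp
qed

lemma positive_basis_expand:
  assumes "positive_basis u v"
  shows "positive_basis (expand_pre c u) (expand_pre c v)" "positive_basis (expand_post c u) (expand_post c v)"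
  using assms
proof (induction rule: positive_basis.induct)
  case gens
  note b = positive_basis.gens and b' = positive_basis.swap [OF positive_basis.gens]
  case 1
  show ?case using positive_basis.prepend [OF b] positive_basis.swap [OF positive_basis.prepend [OF b']]
    by (cases c) (simp_all add: expand_Cons)
  case 2
  show ?case using positive_basis.append [OF b] positive_basis.swap [OF positive_basis.append [OF b']]
    by (cases c) (simp_all add: expand_Cons)
qed (auto intro: positive_basis.intros)

lemma positive_basis_iff_expanded: "positive_basis u v \<longleftrightarrow> expanded_basis u v"
proof
  assume "positive_basis u v"
  then show "expanded_basis u v"
    by induction
      (auto intro: expanded_basis.intros expanded_basis_swap expanded_basis_append expanded_basis_prepend)
next
  assume "expanded_basis u v"
  then show "positive_basis u v"
    by induction (auto intro: positive_basis.intros positive_basis_expand)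
qed

lemma expand_post_last:
  assumes "w \<noteq> []" shows "last (expand_post c w) = other c"
  using assms other_cases [of "last w" c]
  by (cases w rule: rev_cases) (auto simp: expand_Cons)

lemma expanded_basis_nonempty: "expanded_basis u v \<Longrightarrow> u \<noteq> [] \<and> v \<noteq> []"
  by (induction rule: expanded_basis.induct) simp_all

text \<open>Conjugation by the common last letter \<open>z\<close> is pushed inwards through the last substitution. If that
  substitution is \<open>c \<mapsto> c d\<close>, then \<open>z = d\<close>, and rotating turns it into \<open>c \<mapsto> d c\<close>. If it is \<open>c \<mapsto> d c\<close>, the
  preimages have the same last letter \<open>z\<close> and can be rotated by induction; for \<open>z = c\<close> this moves the two
  letters \<open>d c\<close>, which is one letter too many and is corrected by passing to \<open>c \<mapsto> c d\<close>.\<close>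
lemma expanded_basis_rotate:
  "\<lbrakk>expanded_basis u v; u = u' @ [z]; v = v' @ [z]\<rbrakk> \<Longrightarrow> expanded_basis (z # u') (z # v')"
proof (induction arbitrary: u' v' z rule: expanded_basis.induct)
  case (pre u v c)
  have u: "u \<noteq> []" and v: "v \<noteq> []" using expanded_basis_nonempty [OF pre.hyps] by auto
  obtain u1 x where u1: "u = u1 @ [x]" using u by (cases u rule: rev_cases) auto
  obtain v1 y where v1: "v = v1 @ [y]" using v by (cases v rule: rev_cases) auto
  have xy: "x = z" "y = z"
    using pre.prems u1 v1 other_cases [of x c] other_cases [of y c] by (auto simp: expand_Cons)
  have IH: "expanded_basis (z # u1) (z # v1)" using pre.IH u1 v1 xy by simp
  show ?case
  proof (cases "z = c")
    case True
    have "u' = expand_pre c u1 @ [other c]" "v' = expand_pre c v1 @ [other c]"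
      using pre.prems u1 v1 xy True by (auto simp: expand_Cons)
    then have "z # u' = expand_post c (z # u1)" "z # v' = expand_post c (z # v1)"
      using True by (simp_all add: expand_Cons flip: expand_post_pre)
    then show ?thesis using expanded_basis.post [OF IH, of c] by simp
  next
    case False
    then have z: "z = other c" using other_cases by blast
    have "u' = expand_pre c u1" "v' = expand_pre c v1"
      using pre.prems u1 v1 xy z by (auto simp: expand_Cons)
    then have "z # u' = expand_pre c (z # u1)" "z # v' = expand_pre c (z # v1)"
      using z by (simp_all add: expand_Cons)
    then show ?thesis using expanded_basis.pre [OF IH, of c] by simp
  qed
next
  case (post u v c)
  have "u \<noteq> []" "v \<noteq> []" using expanded_basis_nonempty [OF post.hyps] by auto
  then have z: "z = other c" using post.prems expand_post_last [of u c] by simp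
  have "expand_pre c u @ [other c] = (z # u') @ [other c]"
    using post.prems z by (simp flip: expand_post_pre)
  moreover have "expand_pre c v @ [other c] = (z # v') @ [other c]"
    using post.prems z by (simp flip: expand_post_pre)
  ultimately show ?case using expanded_basis.pre [OF post.hyps, of c] by simp
qed auto

lemma positive_basis_rotate:
  "positive_basis (u @ [z]) (v @ [z]) \<Longrightarrow> positive_basis (z # u) (z # v)"
  unfolding positive_basis_iff_expanded using expanded_basis_rotate by blast

lemma positive_basis_rev: "positive_basis u v \<Longrightarrow> positive_basis (rev u) (rev v)"
  by (induction rule: positive_basis.induct) (auto intro: positive_basis.intros)

lemma positive_basis_nonempty: "positive_basis u v \<Longrightarrow> u \<noteq> [] \<and> v \<noteq> []"
  unfolding positive_basis_iff_expanded by (rule expanded_basis_nonempty)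

section \<open>Conjugates of signed positive bases\<close>

text \<open>A positive word, read with \<open>x\<close> or \<open>x\<inverse>\<close> for the generator \<open>x\<close>, according to a sign for each
  generator.\<close>
definition signed_word :: "('x \<Rightarrow> bool) \<Rightarrow> 'x list \<Rightarrow> 'x letter list" where
  "signed_word s w = map (\<lambda>c. (c, s c)) w"

lemma signed_word_simps [simp]:
  "signed_word s [] = []" "signed_word s (c # w) = (c, s c) # signed_word s w"
  "signed_word s (u @ v) = signed_word s u @ signed_word s v"
  "signed_word s w = [] \<longleftrightarrow> w = []"
  by (simp_all add: signed_word_def)

lemma hd_last_signed_word:
  "w \<noteq> [] \<Longrightarrow> hd (signed_word s w) = (hd w, s (hd w))"
  "w \<noteq> [] \<Longrightarrow> last (signed_word s w) = (last w, s (last w))"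
  by (simp_all add: signed_word_def hd_map last_map)

lemma reduced_signed_word [simp]: "reduced (signed_word s w)"
  by (induction w) (auto simp: reduced_Cons hd_last_signed_word inv_letter_def)

lemma winv_signed_word: "winv (signed_word s w) = signed_word (\<lambda>c. \<not> s c) (rev w)"
  by (simp add: winv_def signed_word_def rev_map inv_letter_def comp_def)

definition signed :: "bool \<Rightarrow> 'g::group_add \<Rightarrow> 'g" where
  "signed e x = (if e then x else - x)"

lemma signed_conj: "signed e (g + x - g) = g + signed e x - g"
  by (simp add: signed_def group_simps del: add_uminus_conv_diff)

text \<open>Signs may be chosen for the two generators and for the two components, so that the relation is
  invariant under inverting a component for trivial reasons.\<close>
definition conj_positive :: "gen fgroup \<Rightarrow> gen fgroup \<Rightarrow> bool" where
  "conj_positive x y \<longleftrightarrow> (\<exists>g s u v e1 e2. positive_basis u v \<and>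
     x = g + signed e1 (cls (signed_word s u)) - g \<and>
     y = g + signed e2 (cls (signed_word s v)) - g)"

lemma conj_positiveI:
  "positive_basis u v \<Longrightarrow>
   conj_positive (signed e1 (cls (signed_word s u))) (signed e2 (cls (signed_word s v)))"
  unfolding conj_positive_def by (rule exI [of _ 0]) (auto simp del: signed_word_simps)

lemma conj_positive_swap: "conj_positive x y \<Longrightarrow> conj_positive y x"
  unfolding conj_positive_def using positive_basis.swap by blast

lemma conj_positive_uminus:
  assumes "conj_positive x y" shows "conj_positive (- x) y"
proof -
  have "- (g + signed e1 x - g) = g + signed (\<not> e1) x - g" for g e1 and x :: "gen fgroup"
    by (simp add: signed_def group_simps del: add_uminus_conv_diff)
  then show ?thesis using assms unfolding conj_positive_def by metis
qed

lemma conj_positive_signed: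
  assumes "conj_positive x y" shows "conj_positive (signed e1 x) (signed e2 y)"
  using assms conj_positive_uminus conj_positive_swap unfolding signed_def by metis

lemma conj_positive_conj:
  assumes "conj_positive x y" shows "conj_positive (h + x - h) (h + y - h)"
proof -
  have "h + (g + x - g) - h = (h + g) + x - (h + g)" for g and x :: "gen fgroup"
    by (simp add: group_simps del: add_uminus_conv_diff)
  then show ?thesis using assms unfolding conj_positive_def by metis
qed

text \<open>The only move that is not evident from the form of the pairs is the multiplication by an inverse. Here it is
  undone against the last step by which the positive basis was built: from \<open>(u v, v)\<close>
  it leads back to \<open>(u, v)\<close>, and on the other side to \<open>(v (u v)\<inverse>, u v)\<close>, which is \<open>(u\<inverse>, u v)\<close> up to conjugation. At the start, \<open>(a b\<inverse>, b\<inverse>)\<close> is a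
  positive basis for another choice of signs.\<close>
lemma conj_positive_minus:
  assumes "positive_basis u v"
  defines "U \<equiv> \<lambda>s. cls (signed_word s u)" and "V \<equiv> \<lambda>s. cls (signed_word s v)"
  shows "conj_positive (U s - V s) (V s) \<and> conj_positive (V s - U s) (U s)"
  using assms(1) unfolding U_def V_def
proof (induction rule: positive_basis.induct)
  case gens
  have minus: "cls [(c, b)] = - cls [(c, \<not> b)]" for c :: gen and b
    by (simp add: inv_letter_def flip: cls_winv)
  have "conj_positive (cls [(Gen_a, s Gen_a)] + cls [(Gen_b, \<not> s Gen_b)]) (cls [(Gen_b, \<not> s Gen_b)])"
    using conj_positiveI [OF positive_basis.append [OF positive_basis.gens], of True
        "s(Gen_b := \<not> s Gen_b)" True] by (simp add: signed_def flip: cls_append)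
  moreover have "conj_positive (cls [(Gen_b, s Gen_b)] + cls [(Gen_a, \<not> s Gen_a)]) (cls [(Gen_a, \<not> s Gen_a)])"
    using conj_positiveI [OF positive_basis.append [OF positive_basis.swap [OF positive_basis.gens]], of True
        "s(Gen_a := \<not> s Gen_a)" True] by (simp add: signed_def flip: cls_append)
  ultimately show ?case
    using conj_positive_signed [where ?e1.0 = True and ?e2.0 = False] minus [of Gen_a "s Gen_a"] minus [of Gen_b "s Gen_b"]
    unfolding signed_def by simp
next
  case (swap u v)
  then show ?case by blast
next
  case (append u v)
  let ?U = "cls (signed_word s u)" and ?V = "cls (signed_word s v)"
  have "conj_positive ?U ?V"
    using conj_positiveI [OF append.hyps, of True s True] by (simp add: signed_def)
  moreover have "conj_positive (- ?U) (?U + ?V)"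
    using conj_positiveI [OF positive_basis.swap [OF positive_basis.prepend [OF positive_basis.swap [OF append.hyps]]], of False s True]
    by (simp add: signed_def cls_append)
  moreover have "?V - (?U + ?V) = - ?U"
    by (simp add: group_simps del: add_uminus_conv_diff)
  ultimately show ?case by (simp add: cls_append)
next
  case (prepend u v)
  let ?U = "cls (signed_word s u)" and ?V = "cls (signed_word s v)"
  have "conj_positive ?U ?V"
    using conj_positiveI [OF prepend.hyps, of True s True] by (simp add: signed_def)
  then have "conj_positive (?V + ?U - ?V) (?V + ?V - ?V)"
    by (rule conj_positive_conj)
  moreover have "conj_positive (- ?U) (?U + ?V)"
    using conj_positiveI [OF positive_basis.swap [OF positive_basis.prepend [OF positive_basis.swap [OF prepend.hyps]]], of False s True]
    by (simp add: signed_def cls_append)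
  then have "conj_positive (?V + - ?U - ?V) (?V + (?U + ?V) - ?V)"
    by (rule conj_positive_conj)
  then have "conj_positive (?V - (?V + ?U)) (?V + ?U)"
    by (simp add: group_simps del: add_uminus_conv_diff)
  ultimately show ?case by (simp add: cls_append)
qed

theorem conj_positive_add:
  assumes "conj_positive x y" shows "conj_positive (x + y) y"
proof -
  obtain g s u v e1 e2 where uv: "positive_basis u v"
    and xy: "x = g + signed e1 (cls (signed_word s u)) - g" "y = g + signed e2 (cls (signed_word s v)) - g"
    using assms unfolding conj_positive_def by blast
  let ?U = "cls (signed_word s u)" and ?V = "cls (signed_word s v)"
  have mixed: "conj_positive (?U - ?V) ?V" using conj_positive_minus [OF uv] by blast
  have "conj_positive (signed e1 ?U + signed e2 ?V) (signed e2 ?V)"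
  proof (cases e1; cases e2)
    assume "e1" "e2"
    then show ?thesis using conj_positiveI [OF positive_basis.append [OF uv], of True s True]
      by (simp add: signed_def cls_append)
  next
    assume "e1" "\<not> e2"
    then show ?thesis using conj_positive_signed [OF mixed, of True False] by (simp add: signed_def)
  next
    assume "\<not> e1" "e2"
    moreover have "conj_positive (- ?V + (?U - ?V) - - ?V) (- ?V + ?V - - ?V)"
      using mixed by (rule conj_positive_conj)
    then have "conj_positive (- (- ?U + ?V)) ?V"
      by (simp add: group_simps del: add_uminus_conv_diff)
    ultimately show ?thesis using conj_positive_uminus by (fastforce simp: signed_def)
  next
    assume "\<not> e1" "\<not> e2"
    then show ?thesis using conj_positiveI [OF positive_basis.prepend [OF uv], of False s False]
      by (simp add: signed_def cls_append minus_add)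
  qed
  from conj_positive_conj [OF this, of g] show ?thesis
    unfolding xy by (simp add: group_simps del: add_uminus_conv_diff)
qed

section \<open>Reduction of generating pairs by Nielsen moves\<close>

definition len :: "'x fgroup \<Rightarrow> nat" where
  "len x = length (nf x)"

lemma len_uminus [simp]: "len (- x) = len x"
  by (simp add: len_def nf_uminus)

lemma length_reduce_le: "length (reduce w) \<le> length w"
  unfolding reduce_def by (induction w) (auto simp: cons_reduce_def)

lemma len_cls_le: "len (cls w) \<le> length w"
  by (simp add: len_def nf_cls length_reduce_le)

lemma len_eq_0_iff: "len x = 0 \<longleftrightarrow> x = 0"
  by (metis cls_Nil cls_nf len_def length_0_conv nf_cls reduce_Nil)

text \<open>The number of letters that vanish from either factor when two reduced words are multiplied.\<close>
definition cancellation :: "'x fgroup \<Rightarrow> 'x fgroup \<Rightarrow> nat" where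
  "cancellation x y = (len x + len y - len (x + y)) div 2"

lemma reduced_append_cancel:
  "\<lbrakk>reduced u; reduced v\<rbrakk> \<Longrightarrow> \<exists>p s q. u = p @ s \<and> v = winv s @ q \<and> reduced (p @ q)"
proof (induction u arbitrary: v rule: rev_induct)
  case Nil
  then show ?case by auto
next
  case (snoc l u)
  show ?case
  proof (cases "v \<noteq> [] \<and> hd v = inv_letter l")
    case True
    then obtain v' where v: "v = inv_letter l # v'" by (cases v) auto
    have "reduced u" "reduced v'" using snoc.prems v by (auto simp: reduced_append reduced_Cons)
    then obtain p s q where "u = p @ s" "v' = winv s @ q" "reduced (p @ q)" using snoc.IH by blast
    then show ?thesis using v by (intro exI [of _ p] exI [of _ "s @ [l]"] exI [of _ q]) simp
  next
    case False
    then have "reduced ((u @ [l]) @ v)" using snoc.prems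
      unfolding reduced_append [of "u @ [l]" v] by auto
    then show ?thesis by (metis append_Nil append_Nil2 winv_simps(1))
  qed
qed

lemma cancellation_split:
  obtains p s q where "nf x = p @ s" "nf y = winv s @ q" "nf (x + y) = p @ q"
    "length s = cancellation x y"
proof -
  obtain p s q where psq: "nf x = p @ s" "nf y = winv s @ q" "reduced (p @ q)"
    using reduced_append_cancel [of "nf x" "nf y"] by auto
  have "cls (p @ q) = cls (nf x) + cls (nf y)"
    unfolding psq by (simp add: cls_append cls_winv group_simps del: add_uminus_conv_diff cls_nf)
  then have "nf (x + y) = p @ q" using psq(3) by (intro nf_unique) simp_all
  moreover have "length s = cancellation x y"
    using psq calculation by (simp add: cancellation_def len_def)
  ultimately show ?thesis using psq that by blast
qed

lemma len_add: "len (x + y) + 2 * cancellation x y = len x + len y"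
proof -
  obtain p s q where "nf x = p @ s" "nf y = winv s @ q" "nf (x + y) = p @ q"
    "length s = cancellation x y" by (rule cancellation_split)
  then show ?thesis by (simp add: len_def)
qed

text \<open>Letters that cancel in \<open>x x\<close> sit in mirror positions of the word \<open>x\<close> and are inverse to each other. If
  this reached the middle, the middle letter would be its own inverse, or the two middle letters of
  the reduced word would cancel.\<close>
lemma cancellation_self:
  assumes "x \<noteq> 0" shows "2 * cancellation x x < len x"
proof (rule ccontr)
  assume neg: "\<not> ?thesis"
  let ?w = "nf x" and ?n = "len x"
  obtain p s q where psq: "?w = p @ s" "?w = winv s @ q" "length s = cancellation x x"
    by (rule cancellation_split [of x x]) blast
  have "?n > 0" using assms len_eq_0_iff by (metis neq0_conv)
  have sym: "?w ! i = inv_letter (?w ! (?n - 1 - i))" if "i < length s" for i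
  proof -
    have "?w ! i = winv s ! i" using that unfolding psq(2) by (simp add: nth_append)
    also have "\<dots> = inv_letter (s ! (length s - 1 - i))"
      using that by (simp add: winv_def rev_nth)
    also have "s ! (length s - 1 - i) = ?w ! (?n - 1 - i)"
    proof -
      have "?n - 1 - i = length p + (length s - 1 - i)"
        using that unfolding len_def psq(1) by simp
      then show ?thesis unfolding psq(1) by (simp only: nth_append_length_plus)
    qed
    finally show ?thesis .
  qed
  show False
  proof (cases "even ?n")
    case True
    then obtain m where m: "?n = 2 * m" "m > 0" using \<open>?n > 0\<close> by auto
    have eq: "?w ! (m - 1) = inv_letter (?w ! m)"
      using sym [of "m - 1"] neg m psq(3) by (simp add: mult_2)
    have "reduced (take m ?w @ drop m ?w)" by simp
    then have "hd (drop m ?w) \<noteq> inv_letter (last (take m ?w))"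
      using m by (simp only: reduced_append) (auto simp: len_def)
    moreover have "take m ?w \<noteq> []" using m by (auto simp: len_def)
    then have "last (take m ?w) = ?w ! (m - 1)" "hd (drop m ?w) = ?w ! m"
      using m by (simp_all add: hd_drop_conv_nth last_conv_nth len_def min_def)
    ultimately have "?w ! m \<noteq> inv_letter (?w ! (m - 1))" by simp
    with eq show False by simp
  next
    case False
    then obtain m where m: "?n = 2 * m + 1" by (auto elim: oddE)
    have "?w ! m = inv_letter (?w ! m)"
      using sym [of m] neg m psq(3) by simp
    then show False by simp
  qed
qed

text \<open>If in every product of three factors a part of the middle one survives, then each factor of a long
  reduced product leaves at least one letter. The induction keeps track of the part of the last
  factor \<open>l\<close> that is left before the next multiplication: it is \<open>l\<close> without its first \<open>d\<close> letters.\<close>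
lemma len_word_sum_ge:
  fixes \<sigma> :: "'i \<Rightarrow> 'x fgroup"
  defines "val \<equiv> \<lambda>l. word_sum \<sigma> [l]"
  assumes survive: "\<And>k l m. \<lbrakk>l \<noteq> inv_letter k; m \<noteq> inv_letter l\<rbrakk> \<Longrightarrow>
      cancellation (val k) (val l) + cancellation (val l) (val m) < len (val l)"
    and "reduced s"
  shows "length s \<le> len (word_sum \<sigma> s)"
proof (cases s rule: rev_cases)
  case (snoc t l)
  have "\<exists>y d. nf (word_sum \<sigma> (t @ [l])) = y @ drop d (nf (val l)) \<and> length t \<le> length y \<and>
      (\<forall>m. m \<noteq> inv_letter l \<longrightarrow> d + cancellation (val l) (val m) < len (val l))"
    if "reduced (t @ [l])" for t l
    using that
  proof (induction t arbitrary: l rule: rev_induct)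
    case Nil
    have "cancellation (val l) (val m) < len (val l)" if "m \<noteq> inv_letter l" for m
      using survive [of l l m] that by simp
    then show ?case by (intro exI [of _ "[]"] exI [of _ 0]) (auto simp: val_def)
  next
    case (snoc l t m)
    have red: "reduced (t @ [l])" "m \<noteq> inv_letter l"
      using snoc.prems unfolding reduced_append [of "t @ [l]"] by auto
    obtain y d where y: "nf (word_sum \<sigma> (t @ [l])) = y @ drop d (nf (val l))" "length t \<le> length y"
      "d + cancellation (val l) (val m) < len (val l)"
      using snoc.IH [OF red(1)] red(2) by blast
    obtain p r q where prq: "nf (val l) = p @ r" "nf (val m) = winv r @ q" "nf (val l + val m) = p @ q"
      "length r = cancellation (val l) (val m)"
      by (rule cancellation_split)
    have d: "d < length p" using y(3) prq by (simp add: len_def)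
    have "reduced (y @ drop d p @ r)" using y(1) prq(1) d reduced_nf [of "word_sum \<sigma> (t @ [l])"] by simp
    then have 1: "reduced (y @ drop d p)" unfolding append_assoc [symmetric] by (rule reduced_appendD)
    have "take d p @ drop d p @ q = nf (val l + val m)"
      unfolding prq(3) by (metis append.assoc append_take_drop_id)
    then have 2: "reduced (drop d p @ q)" by (metis reduced_appendD(2) reduced_nf)
    have red': "reduced (y @ drop d p @ q)" using 1 2 d by (intro reduced_overlap) auto
    have "word_sum \<sigma> ((t @ [l]) @ [m]) = word_sum \<sigma> (t @ [l]) + val m" by (simp only: word_sum_append val_def)
    also have "\<dots> = cls (nf (word_sum \<sigma> (t @ [l]))) + cls (nf (val m))" by simp
    also have "\<dots> = cls (y @ drop d p @ q)"
      unfolding y(1) prq using d by (simp add: cls_append cls_winv group_simps del: add_uminus_conv_diff)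
    finally have "nf (word_sum \<sigma> ((t @ [l]) @ [m])) = y @ drop d p @ q"
      using red' by (intro nf_unique) simp_all
    moreover have "q = drop (length r) (nf (val m))" unfolding prq(2) by simp
    moreover have "length (t @ [l]) \<le> length (y @ drop d p)" using y(2) d by simp
    moreover have "length r + cancellation (val m) (val m') < len (val m)" if "m' \<noteq> inv_letter m" for m'
      using survive [OF red(2) that] prq(4) by simp
    ultimately show ?case by (intro exI [of _ "y @ drop d p"] exI [of _ "length r"]) simp
  qed
  then obtain y d where y: "nf (word_sum \<sigma> (t @ [l])) = y @ drop d (nf (val l))" "length t \<le> length y"
    "\<forall>m. m \<noteq> inv_letter l \<longrightarrow> d + cancellation (val l) (val m) < len (val l)"
    using snoc assms(3) by blast
  have "d < len (val l)" using y(3) by (metis add_lessD1 inv_letter_neq(2))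
  then show ?thesis using y(1,2) snoc by (simp add: len_def)
qed simp

text \<open>Applied twice, this shows that a group generated by a single element is commutative.\<close>
lemma subgroup_span_commute:
  assumes "z \<in> subgroup_span S" "\<And>s. s \<in> S \<Longrightarrow> s + c = c + s"
  shows "z + c = c + z"
  using assms(1)
proof induction
  case (add x y)
  then show ?case by (metis add.assoc)
next
  case (uminus x)
  have "- x + c = - x + (c + x) - x" by (simp add: add.assoc flip: add_diff_eq)
  also have "\<dots> = - x + (x + c) - x" using uminus.IH by simp
  also have "\<dots> = c + - x" by (simp add: group_simps del: add_uminus_conv_diff)
  finally show ?case .
qed (simp_all add: assms(2))

lemma split_halves:
  assumes "p @ s = p' @ s'" "length s = length s'" shows "p = p' \<and> s = s'"
  using assms by simp

text \<open>Induction on the total length, for generating pairs. Let \<open>k\<close> and \<open>l\<close> run over the letters that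
  stand for \<open>x\<close>, \<open>y\<close> and their inverses, and let \<open>val\<close> be their values. If some product of two factors
  from different generators is shorter than its first factor, a Nielsen move shortens the pair.
  Otherwise at most half of each factor cancels in such a product. A factor \<open>l\<close> can then be consumed
  completely only if both neighbours cancel exactly half of it; they belong to the other generator,
  and they cannot be inverse to each other, so both are the same \<open>k\<close>. Then \<open>l = p q\<inverse>\<close> and
  \<open>k = q m p\<inverse>\<close>, hence \<open>l k = p m p\<inverse>\<close>, and conjugating the pair \<open>(l k, l)\<close> by \<open>p\<inverse>\<close>
  gives the shorter pair \<open>(m, q\<inverse> p)\<close>. If no factor is ever consumed, a product of \<open>n\<close> factors has length at
  least \<open>n\<close>, so the generators \<open>a\<close> and \<open>b\<close> must be among the values of the letters.\<close>
theorem conj_positive_of_span: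
  fixes x y :: "gen fgroup"
  assumes "subgroup_span {x, y} = UNIV"
  shows "conj_positive x y"
  using assms
proof (induction "len x + len y" arbitrary: x y rule: less_induct)
  case less
  define \<sigma> where "\<sigma> i = (if i then x else y)" for i :: bool
  define val where "val l = word_sum \<sigma> [l]" for l
  have range: "range \<sigma> = {x, y}" by (auto simp: \<sigma>_def)
  have val: "val (i, e) = signed e (\<sigma> i)" for i e by (simp add: val_def word_sum_Cons signed_def)
  have val_inv: "val (inv_letter l) = - val l" for l
    by (cases l) (simp add: val inv_letter_def signed_def)
  have signed_span: "subgroup_span {signed e1 u, signed e2 v} = UNIV"
    if "subgroup_span {u, v} = UNIV" for e1 e2 and u v :: "gen fgroup"
    using that span_pair_uminus [of u v] span_pair_uminus [of v u] span_pair_uminus [of v "- u"]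
    by (cases e1; cases e2) (simp_all add: signed_def insert_commute)
  have signed_signed: "signed e (signed e u) = u" for e and u :: "gen fgroup"
    by (simp add: signed_def)
  have span: "subgroup_span {val k, val l} = UNIV" if "fst k \<noteq> fst l" for k l
  proof -
    obtain i e1 j e2 where kl: "k = (i, e1)" "l = (j, e2)" by (cases k; cases l)
    then have "{\<sigma> i, \<sigma> j} = {x, y}" using that by (cases i; cases j) (auto simp: \<sigma>_def)
    then show ?thesis using signed_span [of "\<sigma> i" "\<sigma> j"] less.prems kl by (simp add: val)
  qed
  have from_val: "conj_positive x y" if "conj_positive (val k) (val l)" "fst k \<noteq> fst l" for k l
  proof -
    obtain i e1 j e2 where kl: "k = (i, e1)" "l = (j, e2)" by (cases k; cases l)
    then have "conj_positive (\<sigma> i) (\<sigma> j)"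
      using conj_positive_signed [OF that(1), of e1 e2] by (simp add: val signed_signed)
    then show ?thesis using that(2) kl conj_positive_swap by (cases i; cases j) (auto simp: \<sigma>_def)
  qed
  have len_sum: "len (val k) + len (val l) = len x + len y" if "fst k \<noteq> fst l" for k l
    using that by (cases k; cases l; cases "fst k"; cases "fst l") (auto simp: val signed_def \<sigma>_def)
  have IH: "conj_positive x' y'" if "len x' + len y' < len x + len y" "subgroup_span {x', y'} = UNIV" for x' y'
    using less.hyps that by blast
  show ?case
  proof (cases "\<exists>k l. fst k \<noteq> fst l \<and> len (val k + val l) < len (val k)")
    case True
    then obtain k l where kl: "fst k \<noteq> fst l" "len (val k + val l) < len (val k)" by blast
    then have "conj_positive (val k + val l) (val l)"
      using len_sum [OF kl(1)] span_pair_add [OF span [OF kl(1)]] by (intro IH) auto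
    then have "conj_positive (val k + val l + - val l) (- val l)"
      by (intro conj_positive_add) (metis conj_positive_swap conj_positive_uminus)
    then have "conj_positive (val k) (val (inv_letter l))"
      by (simp add: val_inv)
    then show ?thesis by (rule from_val) (use kl(1) in \<open>simp add: inv_letter_def\<close>)
  next
    case False
    then have n1: "len (val k) \<le> len (val k + val l)" if "fst k \<noteq> fst l" for k l
      using that by (meson not_less)
    have half: "2 * cancellation (val k) (val l) \<le> len (val l)"
      "2 * cancellation (val k) (val l) \<le> len (val k)" if "fst k \<noteq> fst l" for k l
    proof -
      have "len (val (inv_letter l)) \<le> len (val (inv_letter l) + val (inv_letter k))"
        using that by (intro n1) (auto simp: inv_letter_def)
      then have "len (val l) \<le> len (val k + val l)"
        by (metis val_inv len_uminus minus_add)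
      then show "2 * cancellation (val k) (val l) \<le> len (val l)"
        "2 * cancellation (val k) (val l) \<le> len (val k)"
        using len_add [of "val k" "val l"] n1 [OF that] by linarith+
    qed
    show ?thesis
    proof (cases "\<exists>k l p q m. fst k \<noteq> fst l \<and> p \<noteq> [] \<and> length p = length q \<and>
        nf (val l) = p @ winv q \<and> nf (val k) = q @ m @ winv p")
      case True
      then obtain k l p q m where klpqm: "fst k \<noteq> fst l" "p \<noteq> []" "length p = length q"
        "nf (val l) = p @ winv q" "nf (val k) = q @ m @ winv p" by blast
      let ?P = "cls p" and ?Q = "cls q" and ?M = "cls m"
      have l: "val l = ?P - ?Q" using arg_cong [OF klpqm(4), of cls] by (simp add: cls_append cls_winv)
      have k: "val k = ?Q + ?M - ?P"
        using arg_cong [OF klpqm(5), of cls] by (simp add: cls_append cls_winv group_simps del: add_uminus_conv_diff)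
      have kl: "val l + val k = ?P + ?M - ?P"
        unfolding k l by (simp add: group_simps del: add_uminus_conv_diff)
      have len_l: "len (val l) = 2 * length p" using klpqm by (simp add: len_def)
      have len_k: "len (val k) = length m + 2 * length p" using klpqm by (simp add: len_def)
      have "- val l + (val l + val k) \<in> subgroup_span {val l + val k, val l}"
        by (intro subgroup_span.add subgroup_span.uminus subgroup_span.base) auto
      then have "subgroup_span {val l + val k, val l} = UNIV"
        by (intro span_pair_change [OF span [OF klpqm(1)]])
          (auto intro: subgroup_span.base simp: group_simps simp del: add_uminus_conv_diff)
      from span_pair_conj [OF this, of "- ?P"]
      moreover have "- ?P + (val l + val k) - - ?P = ?M" "- ?P + val l - - ?P = - ?Q + ?P"
        by (simp only: kl) (simp_all add: l group_simps del: add_uminus_conv_diff)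
      ultimately have "subgroup_span {?M, - ?Q + ?P} = UNIV"
        by (simp only:)
      moreover have "len (- ?Q + ?P) \<le> len (val l)"
        using len_cls_le [of "winv q @ p"] klpqm(3) len_l by (simp add: cls_append cls_winv)
      moreover have "len ?M < len (val k)"
        using len_cls_le [of m] len_k klpqm(2) by (cases p) auto
      ultimately have "conj_positive ?M (- ?Q + ?P)"
        using len_sum [OF klpqm(1)] by (intro IH) auto
      then have "conj_positive (?P + ?M - ?P) (?P + (- ?Q + ?P) - ?P)"
        by (rule conj_positive_conj)
      moreover have "?P + (- ?Q + ?P) - ?P = val l"
        by (simp add: l group_simps del: add_uminus_conv_diff)
      ultimately have "conj_positive (val l + val k) (val l)"
        by (simp only: kl)
      then have "conj_positive (- val k + - val l) (val l)"
        using conj_positive_uminus [of "val l + val k"] by (simp add: minus_add)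
      then have "conj_positive (- val k + - val l + val l) (val l)"
        by (rule conj_positive_add)
      then have "conj_positive (- val k) (val l)"
        by (simp add: group_simps del: add_uminus_conv_diff)
      then have "conj_positive (val k) (val l)" using conj_positive_uminus by fastforce
      then show ?thesis using klpqm(1) by (intro from_val)
    next
      case n2: False
      \<comment> \<open>If one component were trivial, the other one would generate a noncommutative group.\<close>
      have ne: "val l \<noteq> 0" for l
      proof
        assume 0: "val l = 0"
        let ?k = "(\<not> fst l, True)"
        have span_l: "z \<in> subgroup_span {0, val ?k}" for z using span [of l ?k] 0 by simp
        have comm_k: "z + val ?k = val ?k + z" for z
          by (rule subgroup_span_commute [OF span_l]) auto
        have "z + z' = z' + z" for z z' :: "gen fgroup"
          by (rule subgroup_span_commute [OF span_l]) (auto simp: comm_k)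
        then have "nf (of_gen Gen_a + of_gen Gen_b) = nf (of_gen Gen_b + of_gen Gen_a)" by metis
        then show False
          by (simp add: of_gen_def nf_cls reduce_reduced reduced_Cons inv_letter_def flip: cls_append)
      qed
      have survive: "cancellation (val k) (val l) + cancellation (val l) (val m) < len (val l)"
        if kl: "l \<noteq> inv_letter k" and lm: "m \<noteq> inv_letter l" for k l m
      proof -
        have self: "2 * cancellation (val l) (val l) < len (val l)" for l
          using cancellation_self [OF ne] .
        have same: "k = l" if "fst k = fst l" "l \<noteq> inv_letter k" for k l :: "bool letter"
          using that by (cases k; cases l) (auto simp: inv_letter_def)
        have le: "2 * cancellation (val k) (val l) \<le> len (val l)" "2 * cancellation (val l) (val m) \<le> len (val l)"
          using half(1) [of k l] half(2) [of l m] same [OF _ kl] same [OF _ lm] self [of l]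
          by (metis less_imp_le_nat)+
        show ?thesis
        proof (rule ccontr)
          assume "\<not> ?thesis"
          then have eq: "2 * cancellation (val k) (val l) = len (val l)" "2 * cancellation (val l) (val m) = len (val l)"
            using le by auto
          have fst: "fst k \<noteq> fst l" "fst l \<noteq> fst m"
            using same [OF _ kl] same [OF _ lm] self [of l] eq by force+
          obtain p s q where psq: "nf (val k) = p @ s" "nf (val l) = winv s @ q"
            "length s = cancellation (val k) (val l)" by (rule cancellation_split [of "val k" "val l"]) blast
          obtain p' s' q' where psq': "nf (val l) = p' @ s'" "nf (val m) = winv s' @ q'"
            "length s' = cancellation (val l) (val m)" by (rule cancellation_split [of "val l" "val m"]) blast
          have len_s: "length s = length s'" using eq psq(3) psq'(3) by simp
          have "length q = length s'" using eq psq(2,3) psq'(3) by (simp add: len_def)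
          then have q: "q = s'" using split_halves [of "winv s" q p' s'] psq(2) psq'(1) by simp
          have s_ne: "s \<noteq> []" using psq(3) eq(1) ne [of l] len_eq_0_iff [of "val l"] by auto
          consider "m = k" | "m = inv_letter k"
            using fst by (cases k; cases m; cases l) (auto simp: inv_letter_def)
          then show False
          proof cases
            case 1
            have "length s' + length s \<le> len (val k)"
              using half(2) [OF fst(1)] psq(3) len_s by simp
            then have "length (winv s') \<le> length p" using psq(1) by (simp add: len_def)
            moreover have "p @ s = winv s' @ q'" using psq(1) psq'(2) 1 by simp
            ultimately obtain r where "p = winv s' @ r"
              by (metis append_eq_append_conv_if append_take_drop_id)
            then have "nf (val k) = winv s' @ r @ winv (winv s)" using psq(1) by simp
            moreover have "nf (val l) = winv s @ winv (winv s')" using psq(2) q by simp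
            moreover have "winv s \<noteq> []" "length (winv s) = length (winv s')" using s_ne len_s by simp_all
            ultimately show False using n2 fst(1) by blast
          next
            case 2
            then have "winv (nf (val k)) = winv s' @ q'" using psq'(2) by (simp add: val_inv nf_uminus)
            then have "winv (winv (nf (val k))) = winv (winv s' @ q')" by (rule arg_cong)
            then have "nf (val k) = winv q' @ s'" by simp
            then have "p @ s = winv q' @ s'" using psq(1) by (rule trans [OF sym, rotated])
            then have "s = s'" using len_s by (rule conjunct2 [OF split_halves])
            then have "reduced (winv s @ s)" using reduced_nf [of "val l"] psq(2) q by simp
            then show False using s_ne reduce_winv_left [of s] by (simp add: reduce_reduced)
          qed
        qed
      qed
      have "\<exists>l. val l = of_gen c" for c
      proof -
        have "of_gen c \<in> subgroup_span (range \<sigma>)" using less.prems range by simp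
        then obtain s where s: "reduced s" "word_sum \<sigma> s = of_gen c" by (rule subgroup_span_word_sum)
        have nf_gen: "nf (of_gen c) = [(c, True)]" by (simp add: of_gen_def nf_cls reduce_reduced)
        have "length s \<le> len (word_sum \<sigma> s)"
          using survive s(1) unfolding val_def by (intro len_word_sum_ge)
        then have "length s \<le> 1" using s(2) nf_gen by (simp add: len_def)
        moreover have "s \<noteq> []"
        proof
          assume "s = []"
          then have "nf (of_gen c) = []" using s(2) nf_cls [of "[]"] by (simp add: cls_Nil)
          then show False using nf_gen by simp
        qed
        ultimately obtain l where "s = [l]" by (cases s) auto
        then show ?thesis using s(2) unfolding val_def by blast
      qed
      then obtain k l where kl: "val k = of_gen Gen_a" "val l = of_gen Gen_b" by metis
      have "fst k \<noteq> fst l"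
      proof
        assume "fst k = fst l"
        then have "k = l \<or> l = inv_letter k" by (cases k; cases l) (auto simp: inv_letter_def)
        then have "of_gen Gen_b = of_gen Gen_a \<or> of_gen Gen_b = - of_gen Gen_a" using kl val_inv [of k] by auto
        then have "nf (of_gen Gen_b) = nf (of_gen Gen_a) \<or> nf (of_gen Gen_b) = winv (nf (of_gen Gen_a))"
          by (metis nf_uminus)
        then show False by (simp add: of_gen_def nf_cls reduce_reduced inv_letter_def)
      qed
      moreover have "conj_positive (of_gen Gen_a) (of_gen Gen_b)"
        using conj_positiveI [OF positive_basis.gens, of True "\<lambda>_. True" True] by (simp add: signed_def of_gen_def)
      ultimately show ?thesis using from_val [of k l] kl by simp
    qed
  qed
qed

section \<open>Machines that also store inverses\<close>

definition subst_word :: "('y \<Rightarrow> 'x letter list) \<Rightarrow> 'y letter list \<Rightarrow> 'x letter list" where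
  "subst_word \<sigma> w = concat (map (\<lambda>l. if snd l then \<sigma> (fst l) else winv (\<sigma> (fst l))) w)"

lemma subst_word_simps [simp]:
  "subst_word \<sigma> [] = []"
  "subst_word \<sigma> ((y, True) # w) = \<sigma> y @ subst_word \<sigma> w"
  "subst_word \<sigma> ((y, False) # w) = winv (\<sigma> y) @ subst_word \<sigma> w"
  "subst_word \<sigma> (u @ w) = subst_word \<sigma> u @ subst_word \<sigma> w"
  by (simp_all add: subst_word_def)

lemma subst_word_winv: "subst_word \<sigma> (winv w) = winv (subst_word \<sigma> w)"
proof (induction w)
  case (Cons l w)
  then show ?case by (cases l; cases "snd l") (simp_all add: inv_letter_def)
qed simp

abbreviation run :: "('r \<Rightarrow> 'x letter list) \<Rightarrow> ('x + 'r) letter list \<Rightarrow> 'x letter list" where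
  "run v \<equiv> subst_word (case_sum (\<lambda>x. [(x, True)]) v)"

text \<open>Contents are concatenated as they are, without free reduction.\<close>
inductive reachable_words :: "('r \<Rightarrow> ('x + 'r) letter list) set \<Rightarrow> ('r \<Rightarrow> 'x letter list) \<Rightarrow> ('r \<Rightarrow> 'x letter list) \<Rightarrow> bool"
  for F v0 where
  init: "reachable_words F v0 v0"
| step: "\<lbrakk>reachable_words F v0 v; f \<in> F\<rbrakk> \<Longrightarrow> reachable_words F v0 (\<lambda>r. run v (f r))"

definition emit :: "('x letter \<Rightarrow> 'a) \<Rightarrow> ('r \<Rightarrow> 'x letter list) \<Rightarrow> ('a + 'r letter) list \<Rightarrow> 'a list" where
  "emit e v = eval_regs (\<lambda>l. map e (subst_word v [l]))"

text \<open>Every register \<open>r\<close> is implemented by two registers, for the content and for its inverse. The update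
  of the latter is the formal inverse of the update of the former, so the two remain inverse to each
  other. The register \<open>None\<close> receives the output, which is a template from \<open>T\<close> filled with the contents.\<close>
theorem EDT0L_word_machine:
  fixes F :: "('r::finite \<Rightarrow> ('x + 'r) letter list) set" and e :: "'x letter \<Rightarrow> 'a::finite"
  assumes F: "finite F" and T: "finite T" "T \<noteq> {}"
  shows "EDT0L UNIV {emit e v t | v t. reachable_words F v0 v \<and> t \<in> T}" (is "EDT0L UNIV ?L")
proof -
  define atom where "atom l = (case fst l of Inl x \<Rightarrow> Inl (e (x, snd l)) | Inr r \<Rightarrow> Inr (Some (r, snd l)))"
    for l :: "('x + 'r) letter"
  define \<alpha> where "\<alpha> f n = (case n of None \<Rightarrow> [Inr None]
      | Some l \<Rightarrow> map atom (if snd l then f (fst l) else winv (f (fst l))))"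
    for f :: "'r \<Rightarrow> ('x + 'r) letter list" and n :: "'r letter option"
  define \<beta> where "\<beta> t n = (case n of None \<Rightarrow> map (map_sum id Some) t | Some l \<Rightarrow> [Inr n])"
    for t :: "('a + 'r letter) list" and n :: "'r letter option"
  obtain t0 where t0: "t0 \<in> T" using T by blast
  \<comment> \<open>The output register starts with the output for the initial contents, since its content must
      belong to the language at all times.\<close>
  define \<nu>0 where "\<nu>0 n = (case n of None \<Rightarrow> emit e v0 t0 | Some l \<Rightarrow> map e (subst_word v0 [l]))" for n
  have eval_\<alpha>: "eval_regs \<nu> (map atom w) = map e (run v w)"
    if "\<And>l. \<nu> (Some l) = map e (subst_word v [l])" for \<nu> v w
  proof (induction w)
    case (Cons l w)
    obtain y b where "l = (y, b)" by (cases l)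
    then show ?case using Cons that
      by (cases y; cases b) (simp_all add: atom_def inv_letter_def)
  qed simp
  have \<alpha>: "eval_regs \<nu> (\<alpha> f (Some l)) = map e (subst_word (\<lambda>r. run v (f r)) [l])"
    if "\<And>l. \<nu> (Some l) = map e (subst_word v [l])" for \<nu> v f l
    using eval_\<alpha> [OF that] by (cases l; cases "snd l") (simp_all add: \<alpha>_def subst_word_winv)
  have \<beta>: "eval_regs \<nu> (\<beta> t None) = emit e v t"
    if "\<And>l. \<nu> (Some l) = map e (subst_word v [l])" for \<nu> v t
  proof -
    have "eval_regs \<nu> (map (map_sum id Some) t) = emit e v t"
    proof (induction t)
      case (Cons d t)
      then show ?case by (cases d) (simp_all add: emit_def that)
    qed (simp add: emit_def)
    then show ?thesis by (simp add: \<beta>_def)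
  qed
  let ?\<Gamma> = "\<alpha> ` F \<union> \<beta> ` T"
  have sound: "\<nu> None \<in> ?L \<and> (\<exists>v. reachable_words F v0 v \<and> (\<forall>l. \<nu> (Some l) = map e (subst_word v [l])))"
    if "reachable ?\<Gamma> \<nu>0 \<nu>" for \<nu>
    using that
  proof induction
    case init
    show ?case using t0 reachable_words.init by (auto simp: \<nu>0_def)
  next
    case (step \<nu> \<eta>)
    then obtain v where v: "reachable_words F v0 v" "\<And>l. \<nu> (Some l) = map e (subst_word v [l])" by blast
    from step.hyps(2) show ?case
    proof
      assume "\<eta> \<in> \<alpha> ` F"
      then obtain f where f: "f \<in> F" "\<eta> = \<alpha> f" by blast
      have "eval_regs \<nu> (\<eta> None) \<in> ?L" using step.IH f by (simp add: \<alpha>_def)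
      then show ?thesis using reachable_words.step [OF v(1) f(1)] \<alpha> [OF v(2)] f(2) by blast
    next
      assume "\<eta> \<in> \<beta> ` T"
      then obtain t where t: "t \<in> T" "\<eta> = \<beta> t" by blast
      have "eval_regs \<nu> (\<eta> (Some l)) = \<nu> (Some l)" for l using t by (simp add: \<beta>_def)
      then show ?thesis using v t \<beta> [OF v(2)] by auto
    qed
  qed
  have complete: "\<exists>\<nu>. reachable ?\<Gamma> \<nu>0 \<nu> \<and> (\<forall>l. \<nu> (Some l) = map e (subst_word v [l]))"
    if "reachable_words F v0 v" for v
    using that
  proof induction
    case init
    show ?case using reachable.init by (intro exI [of _ \<nu>0]) (auto simp: \<nu>0_def)
  next
    case (step v f)
    then obtain \<nu> where \<nu>: "reachable ?\<Gamma> \<nu>0 \<nu>" "\<And>l. \<nu> (Some l) = map e (subst_word v [l])" by blast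
    have "reachable ?\<Gamma> \<nu>0 (\<lambda>n. eval_regs \<nu> (\<alpha> f n))"
      using \<nu>(1) step.hyps by (intro reachable.step) auto
    then show ?case using \<alpha> [OF \<nu>(2)] by blast
  qed
  have "?L = {\<nu> None | \<nu>. reachable ?\<Gamma> \<nu>0 \<nu>}"
  proof (intro equalityI subsetI)
    fix w assume "w \<in> ?L"
    then obtain v t where vt: "reachable_words F v0 v" "t \<in> T" "w = emit e v t" by blast
    obtain \<nu> where \<nu>: "reachable ?\<Gamma> \<nu>0 \<nu>" "\<And>l. \<nu> (Some l) = map e (subst_word v [l])"
      using complete [OF vt(1)] by blast
    have "reachable ?\<Gamma> \<nu>0 (\<lambda>n. eval_regs \<nu> (\<beta> t n))"
      using \<nu>(1) vt by (intro reachable.step) auto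
    moreover have "w = eval_regs \<nu> (\<beta> t None)" using \<beta> [OF \<nu>(2)] vt(3) by simp
    ultimately show "w \<in> {\<nu> None | \<nu>. reachable ?\<Gamma> \<nu>0 \<nu>}"
      unfolding mem_Collect_eq by (intro exI [of _ "\<lambda>n. eval_regs \<nu> (\<beta> t n)"] conjI)
  qed (use sound in blast)
  then show ?thesis using EDT0L_register_machine [of ?\<Gamma> None \<nu>0] F T by simp
qed

section \<open>The machine for bases\<close>

text \<open>The contents of \<open>P1\<close> and \<open>R1\<close> together form the first component \<open>p\<^sub>1\<close> of a positive basis, with the cut
  between them, and \<open>P2\<close> and \<open>R2\<close> likewise form \<open>p\<^sub>2\<close>. The register \<open>N\<close> holds a power of \<open>p\<^sub>1\<close> and \<open>G\<close> the outer
  part of the conjugating word.\<close>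
datatype reg = P1 | R1 | P2 | R2 | N | G

instance reg :: finite
proof
  have *: "UNIV = {P1, R1, P2, R2, N, G}" using reg.exhaust by blast
  show "finite (UNIV :: reg set)" by (simp add: *)
qed

definition regs :: "'b \<Rightarrow> 'b \<Rightarrow> 'b \<Rightarrow> 'b \<Rightarrow> 'b \<Rightarrow> 'b \<Rightarrow> reg \<Rightarrow> 'b" where
  "regs p1 r1 p2 r2 n g r =
     (case r of P1 \<Rightarrow> p1 | R1 \<Rightarrow> r1 | P2 \<Rightarrow> p2 | R2 \<Rightarrow> r2 | N \<Rightarrow> n | G \<Rightarrow> g)"

lemma regs_simps [simp]:
  "regs p1 r1 p2 r2 n g P1 = p1" "regs p1 r1 p2 r2 n g R1 = r1"
  "regs p1 r1 p2 r2 n g P2 = p2" "regs p1 r1 p2 r2 n g R2 = r2"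
  "regs p1 r1 p2 r2 n g N = n" "regs p1 r1 p2 r2 n g G = g"
  by (simp_all add: regs_def)

lemma map_regs: "(\<lambda>r. f (regs p1 r1 p2 r2 n g r)) = regs (f p1) (f r1) (f p2) (f r2) (f n) (f g)"
  by (auto simp: regs_def fun_eq_iff split: reg.split)

type_synonym update = "reg \<Rightarrow> (gen + reg) letter list"

abbreviation read :: "reg \<Rightarrow> (gen + reg) letter" where
  "read r \<equiv> (Inr r, True)"

definition upd_gens :: "(gen \<Rightarrow> bool) \<Rightarrow> update" where
  "upd_gens s = regs [(Inl Gen_a, s Gen_a)] [] [(Inl Gen_b, s Gen_b)] [] [] []"

definition upd_swap :: update where
  "upd_swap = regs [read P2] [read R2] [read P1] [read R1] [] []"

text \<open>The flag tells whether the cut of the new first component \<open>p\<^sub>1 p\<^sub>2\<close> is the cut of \<open>p\<^sub>1\<close> or the cut of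
  \<open>p\<^sub>2\<close>; in \<open>upd_prepend\<close> it tells this for \<open>p\<^sub>2 p\<^sub>1\<close>. Since \<open>N\<close> must remain a power of \<open>p\<^sub>1\<close>, it is
  emptied whenever \<open>p\<^sub>1\<close> changes.\<close>
definition upd_append :: "bool \<Rightarrow> update" where
  "upd_append b =
     (if b then regs [read P1] [read R1, read P2, read R2] [read P2] [read R2] [] []
      else regs [read P1, read R1, read P2] [read R2] [read P2] [read R2] [] [])"

definition upd_prepend :: "bool \<Rightarrow> update" where
  "upd_prepend b =
     (if b then regs [read P2, read R2, read P1] [read R1] [read P2] [read R2] [] []
      else regs [read P2] [read R2, read P1, read R1] [read P2] [read R2] [] [])"

definition upd_power :: update where
  "upd_power = regs [read P1] [read R1] [read P2] [read R2] [read N, read P1, read R1] [read G]"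

definition upd_conj :: "gen letter \<Rightarrow> update" where
  "upd_conj l = regs [read P1] [read R1] [read P2] [read R2] [read N] [read G, (Inl (fst l), snd l)]"

definition updates :: "update set" where
  "updates = range upd_gens \<union> range upd_append \<union> range upd_prepend \<union> range upd_conj \<union> {upd_swap, upd_power}"

abbreviation machine_reaches :: "(reg \<Rightarrow> gen letter list) \<Rightarrow> bool" where
  "machine_reaches \<equiv> reachable_words updates (regs [(Gen_a, True)] [] [(Gen_b, True)] [] [] [])"

lemma machine_reaches_update:
  "\<lbrakk>machine_reaches v; regs p1 r1 p2 r2 n g \<in> updates\<rbrakk> \<Longrightarrow>
   machine_reaches (regs (run v p1) (run v r1) (run v p2) (run v r2) (run v n) (run v g))"
  using reachable_words.step [of updates _ v "regs p1 r1 p2 r2 n g"] by (simp only: map_regs)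

lemma machine_reaches_gens:
  assumes "machine_reaches v" shows "machine_reaches (regs [(Gen_a, s Gen_a)] [] [(Gen_b, s Gen_b)] [] [] [])"
proof -
  have "run v [(Inl x, b)] = [(x, b)]" for x b by (cases b) (simp_all add: inv_letter_def)
  moreover have "regs [(Inl Gen_a, s Gen_a)] [] [(Inl Gen_b, s Gen_b)] [] [] [] \<in> updates"
    unfolding updates_def upd_gens_def [symmetric] by blast
  ultimately show ?thesis using machine_reaches_update [OF assms] by fastforce
qed

lemma machine_reaches_step:
  assumes "machine_reaches (regs p1 r1 p2 r2 n g)"
  shows "machine_reaches (regs p2 r2 p1 r1 [] [])"
    and "machine_reaches (regs p1 (r1 @ p2 @ r2) p2 r2 [] [])"
    and "machine_reaches (regs (p1 @ r1 @ p2) r2 p2 r2 [] [])"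
    and "machine_reaches (regs (p2 @ r2 @ p1) r1 p2 r2 [] [])"
    and "machine_reaches (regs p2 (r2 @ p1 @ r1) p2 r2 [] [])"
    and "machine_reaches (regs p1 r1 p2 r2 (n @ p1 @ r1) g)"
    and "machine_reaches (regs p1 r1 p2 r2 n (g @ [l]))"
proof -
  have "upd_swap \<in> updates" "upd_append True \<in> updates" "upd_append False \<in> updates"
    "upd_prepend True \<in> updates" "upd_prepend False \<in> updates" "upd_power \<in> updates"
    "upd_conj l \<in> updates"
    by (auto simp: updates_def)
  note upd = this [unfolded upd_swap_def upd_append_def upd_prepend_def upd_power_def upd_conj_def if_True if_False]
  show "machine_reaches (regs p2 r2 p1 r1 [] [])"
    using machine_reaches_update [OF assms upd(1)] by simp
  show "machine_reaches (regs p1 (r1 @ p2 @ r2) p2 r2 [] [])"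
    using machine_reaches_update [OF assms upd(2)] by simp
  show "machine_reaches (regs (p1 @ r1 @ p2) r2 p2 r2 [] [])"
    using machine_reaches_update [OF assms upd(3)] by simp
  show "machine_reaches (regs (p2 @ r2 @ p1) r1 p2 r2 [] [])"
    using machine_reaches_update [OF assms upd(4)] by simp
  show "machine_reaches (regs p2 (r2 @ p1 @ r1) p2 r2 [] [])"
    using machine_reaches_update [OF assms upd(5)] by simp
  show "machine_reaches (regs p1 r1 p2 r2 (n @ p1 @ r1) g)"
    using machine_reaches_update [OF assms upd(6)] by simp
  show "machine_reaches (regs p1 r1 p2 r2 n (g @ [l]))"
    using machine_reaches_update [OF assms upd(7)] by (cases l; cases "snd l") (simp_all add: inv_letter_def)
qed

text \<open>With \<open>h = G R1 N\<close>, the words \<open>out1\<close> and \<open>out2\<close> represent the conjugates of \<open>p\<^sub>1 = P1 R1\<close> and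
  \<open>p\<^sub>2 = P2 R2\<close> by \<open>h\<close>. In \<open>out1\<close> the powers of \<open>p\<^sub>1\<close> and the factors \<open>R1 R1\<inverse>\<close> have already been
  cancelled.\<close>
definition out1 :: "reg letter list" where
  "out1 = [(G, True), (R1, True), (P1, True), (G, False)]"

definition out2 :: "reg letter list" where
  "out2 = [(G, True), (R1, True), (N, True), (P2, True), (R2, True), (N, False), (R1, False), (G, False)]"

lemma freely_generates_changes:
  assumes "freely_generates [x, y]"
  shows "freely_generates [y + x, y]" "freely_generates [x, - y]"
proof -
  show "freely_generates [x, - y]"
    using assms freely_generates_swap freely_generates_uminus by blast
  show "freely_generates [y + x, y]"
    using freely_generates_conj [OF freely_generates_add [OF assms], of y]
    by (simp add: group_simps del: add_uminus_conv_diff)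
qed

text \<open>The updates restart with two signed generators, perform a Nielsen move on the pair \<open>(p\<^sub>1, p\<^sub>2)\<close> or
  leave it unchanged. Since \<open>N\<close> commutes with \<open>p\<^sub>1\<close>, conjugating by \<open>N\<close> affects only \<open>p\<^sub>2\<close>.\<close>
lemma machine_reaches_invariant:
  assumes "machine_reaches v"
  shows "freely_generates [cls (v P1 @ v R1), cls (v P2 @ v R2)] \<and>
    cls (v N) + cls (v P1 @ v R1) = cls (v P1 @ v R1) + cls (v N)"
  using assms
proof induction
  case init
  show ?case using freely_generates_gens by (simp add: of_gen_def cls_Nil)
next
  case (step v f)
  let ?X = "cls (v P1 @ v R1)" and ?Y = "cls (v P2 @ v R2)"
  have fg: "freely_generates [?X, ?Y]" and comm: "cls (v N) + ?X = ?X + cls (v N)"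
    using step.IH by auto
  consider s where "f = upd_gens s" | "f = upd_swap" | c where "f = upd_append c"
    | c where "f = upd_prepend c" | "f = upd_power" | l where "f = upd_conj l"
    using step.hyps(2) unfolding updates_def by blast
  then show ?case
  proof cases
    case 1
    have "run v [(Inl x, b)] = [(x, b)]" for x b by (cases b) (simp_all add: inv_letter_def)
    moreover have "cls [(x, b)] = (if b then of_gen x else - of_gen x)" for x :: gen and b
      by (simp add: of_gen_def inv_letter_def flip: cls_winv)
    ultimately show ?thesis
      using freely_generates_gens freely_generates_uminus [OF freely_generates_gens]
        freely_generates_changes(2) [OF freely_generates_gens]
        freely_generates_changes(2) [OF freely_generates_uminus [OF freely_generates_gens]]
      by (simp add: 1 upd_gens_def cls_Nil)
  next
    case 2
    show ?thesis using freely_generates_swap [OF fg] by (simp add: 2 upd_swap_def cls_Nil)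
  next
    case 3
    show ?thesis using freely_generates_add [OF fg]
      by (cases c) (simp_all add: 3 upd_append_def cls_Nil cls_append add.assoc)
  next
    case 4
    show ?thesis using freely_generates_changes(1) [OF fg]
      by (cases c) (simp_all add: 4 upd_prepend_def cls_Nil cls_append add.assoc)
  next
    case 5
    have "cls (v N) + ?X + ?X = ?X + (cls (v N) + ?X)"
      using comm by (metis add.assoc)
    then show ?thesis using fg by (simp add: 5 upd_power_def cls_append add.assoc)
  next
    case 6
    show ?thesis using fg comm by (simp add: 6 upd_conj_def)
  qed
qed

lemma machine_reaches_free_basis:
  assumes "machine_reaches v"
  shows "freely_generates [cls (subst_word v out1), cls (subst_word v out2)]"
proof -
  let ?X = "cls (v P1 @ v R1)" and ?Y = "cls (v P2 @ v R2)"
  let ?h = "cls (v G) + cls (v R1) + cls (v N)"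
  have comm: "cls (v N) + ?X = ?X + cls (v N)" using machine_reaches_invariant [OF assms] by blast
  have "?h + ?X - ?h = cls (v G) + cls (v R1) + (cls (v N) + ?X) - ?h"
    by (simp add: add.assoc)
  also have "\<dots> = cls (subst_word v out1)"
    unfolding comm by (simp add: out1_def cls_append cls_winv group_simps del: add_uminus_conv_diff)
  finally have 1: "?h + ?X - ?h = cls (subst_word v out1)" .
  have 2: "?h + ?Y - ?h = cls (subst_word v out2)"
    by (simp add: out2_def cls_append cls_winv group_simps del: add_uminus_conv_diff)
  show ?thesis using freely_generates_conj [of ?X ?Y ?h] machine_reaches_invariant [OF assms]
    unfolding 1 2 by blast
qed

section \<open>The machine reaches every basis\<close>

text \<open>The induction cannot prescribe the cuts of both components at the same time: a cut of \<open>u v\<close> inside \<open>v\<close>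
  is obtained from the same cut of \<open>v\<close>, which also remains the cut of the second component. Hence the
  existential quantifiers. Cuts of both components are needed, as either one may be cut in the next step.\<close>
lemma machine_reaches_cuts:
  fixes s :: "gen \<Rightarrow> bool"
  assumes "positive_basis u v"
  defines "reach_cuts \<equiv> \<lambda>u1 u2 v1 v2. machine_reaches (regs (signed_word s u1) (signed_word s u2)
     (signed_word s v1) (signed_word s v2) [] [])"
  shows "(\<forall>u1 u2. u = u1 @ u2 \<longrightarrow> u1 \<noteq> [] \<longrightarrow> (\<exists>v1 v2. v = v1 @ v2 \<and> reach_cuts u1 u2 v1 v2)) \<and>
    (\<forall>v1 v2. v = v1 @ v2 \<longrightarrow> v1 \<noteq> [] \<longrightarrow> (\<exists>u1 u2. u = u1 @ u2 \<and> reach_cuts u1 u2 v1 v2))"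
proof -
  have step: "reach_cuts v1 v2 u1 u2" "reach_cuts u1 (u2 @ v1 @ v2) v1 v2" "reach_cuts (u1 @ u2 @ v1) v2 v1 v2"
    "reach_cuts (v1 @ v2 @ u1) u2 v1 v2" "reach_cuts v1 (v2 @ u1 @ u2) v1 v2"
    if "reach_cuts u1 u2 v1 v2" for u1 u2 v1 v2
    using machine_reaches_step [OF that [unfolded reach_cuts_def]] unfolding reach_cuts_def by simp_all
  show ?thesis using assms(1)
  proof (induction rule: positive_basis.induct)
    case gens
    have "reach_cuts [Gen_a] [] [Gen_b] []"
      unfolding reach_cuts_def using machine_reaches_gens [OF reachable_words.init, of s] by simp
    moreover have cut: "w1 = [x] \<and> w2 = []" if "[x] = w1 @ w2" "w1 \<noteq> []" for x :: gen and w1 w2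
      using that by (cases w1) auto
    ultimately have left: "reach_cuts u1 u2 [Gen_b] []" if "[Gen_a] = u1 @ u2" "u1 \<noteq> []" for u1 u2
      using cut [OF that] by simp
    have right: "reach_cuts [Gen_a] [] v1 v2" if "[Gen_b] = v1 @ v2" "v1 \<noteq> []" for v1 v2
      using cut [OF that] \<open>reach_cuts [Gen_a] [] [Gen_b] []\<close> by simp
    show ?case
    proof (intro conjI allI impI)
      fix u1 u2 assume "[Gen_a] = u1 @ u2" "u1 \<noteq> []"
      then show "\<exists>v1 v2. [Gen_b] = v1 @ v2 \<and> reach_cuts u1 u2 v1 v2"
        by (rule_tac exI [of _ "[Gen_b]"], rule_tac exI [of _ "[]"]) (simp add: left)
    next
      fix v1 v2 assume "[Gen_b] = v1 @ v2" "v1 \<noteq> []"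
      then show "\<exists>u1 u2. [Gen_a] = u1 @ u2 \<and> reach_cuts u1 u2 v1 v2"
        by (rule_tac exI [of _ "[Gen_a]"], rule_tac exI [of _ "[]"]) (simp add: right)
    qed
  next
    case (swap u v)
    show ?case
    proof (intro conjI allI impI)
      fix w1 w2 assume "v = w1 @ w2" "w1 \<noteq> []"
      then obtain x1 x2 where "u = x1 @ x2" "reach_cuts x1 x2 w1 w2" using swap.IH by blast
      then show "\<exists>x1 x2. u = x1 @ x2 \<and> reach_cuts w1 w2 x1 x2" using step(1) by blast
    next
      fix w1 w2 assume "u = w1 @ w2" "w1 \<noteq> []"
      then obtain x1 x2 where "v = x1 @ x2" "reach_cuts w1 w2 x1 x2" using swap.IH by blast
      then show "\<exists>x1 x2. v = x1 @ x2 \<and> reach_cuts x1 x2 w1 w2" using step(1) by blast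
    qed
  next
    case (append u v)
    have "\<exists>v1 v2. v = v1 @ v2 \<and> reach_cuts w1 w2 v1 v2" if w: "u @ v = w1 @ w2" "w1 \<noteq> []" for w1 w2
    proof -
      obtain x where "u = w1 @ x \<and> w2 = x @ v \<or> w1 = u @ x \<and> v = x @ w2"
        using w(1) unfolding append_eq_append_conv2 by metis
      then consider "u = w1 @ x" "w2 = x @ v" | "w1 = u @ x" "v = x @ w2" "x \<noteq> []"
        by (cases "x = []") auto
      then show ?thesis
      proof cases
        case 1
        then obtain v1 v2 where "v = v1 @ v2" "reach_cuts w1 x v1 v2" using append.IH w(2) by blast
        then show ?thesis using step(2) 1 by blast
      next
        case 2
        then obtain u1 u2 where "u = u1 @ u2" "reach_cuts u1 u2 x w2" using append.IH by blast
        then show ?thesis using step(3) 2 by fastforce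
      qed
    qed
    moreover have "\<exists>u1 u2. u @ v = u1 @ u2 \<and> reach_cuts u1 u2 v1 v2" if v: "v = v1 @ v2" "v1 \<noteq> []" for v1 v2
    proof -
      obtain u1 u2 where "u = u1 @ u2" "reach_cuts u1 u2 v1 v2" using append.IH v by blast
      then show ?thesis using step(2) v(1) by (metis append.assoc)
    qed
    ultimately show ?case by blast
  next
    case (prepend u v)
    have "\<exists>v1 v2. v = v1 @ v2 \<and> reach_cuts w1 w2 v1 v2" if w: "v @ u = w1 @ w2" "w1 \<noteq> []" for w1 w2
    proof -
      obtain x where "v = w1 @ x \<and> w2 = x @ u \<or> w1 = v @ x \<and> u = x @ w2"
        using w(1) unfolding append_eq_append_conv2 by metis
      then consider "v = w1 @ x" "w2 = x @ u" | "w1 = v @ x" "u = x @ w2" "x \<noteq> []"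
        by (cases "x = []") auto
      then show ?thesis
      proof cases
        case 1
        then obtain u1 u2 where "u = u1 @ u2" "reach_cuts u1 u2 w1 x" using prepend.IH w(2) by blast
        then show ?thesis using step(5) 1 by blast
      next
        case 2
        then obtain v1 v2 where "v = v1 @ v2" "reach_cuts x w2 v1 v2" using prepend.IH by blast
        then show ?thesis using step(4) 2 by fastforce
      qed
    qed
    moreover have "\<exists>u1 u2. v @ u = u1 @ u2 \<and> reach_cuts u1 u2 v1 v2" if v: "v = v1 @ v2" "v1 \<noteq> []" for v1 v2
    proof -
      obtain u1 u2 where "u = u1 @ u2" "reach_cuts u1 u2 v1 v2" using prepend.IH v by blast
      then show ?thesis using step(5) v(1) by (metis append.assoc)
    qed
    ultimately show ?case by blast
  qed
qed

lemma concat_replicate_snoc: "concat (replicate k p) @ p = concat (replicate (Suc k) p)"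
  by (induction k) simp_all

lemma machine_reaches_power_conj:
  assumes "machine_reaches (regs p1 r1 p2 r2 [] [])"
  shows "machine_reaches (regs p1 r1 p2 r2 (concat (replicate k (p1 @ r1))) g)"
proof (induction g rule: rev_induct)
  case Nil
  show ?case
  proof (induction k)
    case (Suc k)
    show ?case using machine_reaches_step(6) [OF Suc] by (simp only: concat_replicate_snoc)
  qed (simp add: assms)
next
  case (snoc l g)
  then show ?case by (rule machine_reaches_step(7))
qed

lemma longest_common_suffix:
  "\<exists>g' p' r. g = g' @ r \<and> p = p' @ r \<and> (g' \<noteq> [] \<longrightarrow> p' \<noteq> [] \<longrightarrow> last g' \<noteq> last p')"
proof (induction g arbitrary: p rule: rev_induct)
  case (snoc x g)
  show ?case
  proof (cases "p \<noteq> [] \<and> last p = x")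
    case True
    then obtain p0 where p: "p = p0 @ [x]" by (metis append_butlast_last_id)
    obtain g' p' r where "g = g' @ r" "p0 = p' @ r" "g' \<noteq> [] \<longrightarrow> p' \<noteq> [] \<longrightarrow> last g' \<noteq> last p'"
      using snoc.IH by blast
    then show ?thesis by (metis append.assoc p)
  next
    case False
    then have "g @ [x] = (g @ [x]) @ [] \<and> p = p @ [] \<and>
      (g @ [x] \<noteq> [] \<longrightarrow> p \<noteq> [] \<longrightarrow> last (g @ [x]) \<noteq> last p)" by auto
    then show ?thesis by blast
  qed
qed auto

text \<open>The longest common suffix of \<open>g\<close> and the left infinite word \<open>\<dots>ppp\<close>.\<close>
lemma periodic_suffix:
  assumes "p \<noteq> []"
  shows "\<exists>g' p' r k. g = g' @ r @ concat (replicate k p) \<and> p = p' @ r \<and> p' \<noteq> [] \<and>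
    (g' \<noteq> [] \<longrightarrow> last g' \<noteq> last p')"
proof (induction "length g" arbitrary: g rule: less_induct)
  case less
  show ?case
  proof (cases "\<exists>g0. g = g0 @ p")
    case True
    then obtain g0 where g0: "g = g0 @ p" by blast
    then obtain g' p' r k where "g0 = g' @ r @ concat (replicate k p)" "p = p' @ r" "p' \<noteq> []"
      "g' \<noteq> [] \<longrightarrow> last g' \<noteq> last p'"
      using less [of g0] assms by auto
    then show ?thesis using g0 concat_replicate_snoc by (metis append.assoc)
  next
    case False
    obtain g' p' r where *: "g = g' @ r" "p = p' @ r" "g' \<noteq> [] \<longrightarrow> p' \<noteq> [] \<longrightarrow> last g' \<noteq> last p'"
      using longest_common_suffix by blast
    then have "p' \<noteq> []" using False by auto
    then show ?thesis using * by (intro exI [of _ g'] exI [of _ p'] exI [of _ r] exI [of _ 0]) auto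
  qed
qed

lemma signed_word_eq_append:
  assumes "signed_word s u = p @ r"
  obtains u1 u2 where "u = u1 @ u2" "p = signed_word s u1" "r = signed_word s u2"
  using assms unfolding signed_word_def by (auto simp: map_eq_append_conv)

text \<open>The word \<open>g\<close> ends with a letter of the chosen sign, so nothing cancels at its junction with the
  positive words, and as \<open>v\<close> ends with the other generator, \<open>g v g\<inverse>\<close> is reduced. In \<open>g u g\<inverse>\<close> exactly the
  longest suffix of \<open>g\<close> cancels that is also a suffix of a power of \<open>u\<close>.\<close>
lemma machine_reaches_conj:
  fixes s :: "gen \<Rightarrow> bool"
  assumes uv: "positive_basis u v" and g: "reduced g"
    and last_g: "g \<noteq> [] \<Longrightarrow> last g = (c, s c) \<and> last v \<noteq> c"
  defines "conjugate \<equiv> \<lambda>w. nf (cls g + cls (signed_word s w) - cls g)"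
  shows "\<exists>\<mu>. machine_reaches \<mu> \<and> subst_word \<mu> out1 = conjugate u \<and> subst_word \<mu> out2 = conjugate v"
proof -
  let ?p = "signed_word s u" and ?q = "signed_word s v"
  have ne: "u \<noteq> []" "v \<noteq> []" using positive_basis_nonempty [OF uv] by auto
  obtain g' p' r k where g_eq: "g = g' @ r @ concat (replicate k ?p)" and p: "?p = p' @ r"
    and p': "p' \<noteq> []" "g' \<noteq> [] \<longrightarrow> last g' \<noteq> last p'"
    using periodic_suffix [of ?p g] ne by (metis signed_word_simps(4))
  let ?n = "concat (replicate k ?p)"
  obtain u1 u2 where u: "u = u1 @ u2" "p' = signed_word s u1" "r = signed_word s u2"
    using p by (rule signed_word_eq_append)
  then have "u1 \<noteq> []" using p'(1) by auto
  then obtain v1 v2 where v: "v = v1 @ v2"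
    "machine_reaches (regs p' r (signed_word s v1) (signed_word s v2) [] [])"
    using machine_reaches_cuts [OF uv, of s] u by blast
  define \<mu> where "\<mu> = regs p' r (signed_word s v1) (signed_word s v2) ?n g'"
  have \<mu>: "machine_reaches \<mu>"
    using machine_reaches_power_conj [OF v(2), of k g'] unfolding p [symmetric] \<mu>_def .
  have g_pos: "reduced (g @ signed_word s w)" for w
  proof (cases "g = [] \<or> w = []")
    case False
    then have "hd (signed_word s w) \<noteq> inv_letter (last g)"
      using last_g by (auto simp: hd_last_signed_word inv_letter_def)
    then show ?thesis using g by (simp add: reduced_append)
  qed (use g in auto)
  have out2: "subst_word \<mu> out2 = g @ ?q @ winv g"
    unfolding out2_def g_eq \<mu>_def v(1) by simp
  have "reduced (?q @ winv g)"
  proof (cases "g = []")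
    case False
    then have "last g \<noteq> last ?q" using last_g ne(2) by (auto simp: hd_last_signed_word)
    then have "hd (winv g) \<noteq> inv_letter (last ?q)"
      using False by (auto simp: winv_def hd_rev last_map inv_letter_eq_iff)
    then show ?thesis using g by (simp add: reduced_append)
  qed simp
  then have "reduced (g @ ?q @ winv g)"
    using g_pos ne(2) by (intro reduced_overlap) auto
  then have conj_v: "conjugate v = g @ ?q @ winv g"
    unfolding conjugate_def by (rule nf_unique) (simp add: cls_append cls_winv group_simps del: add_uminus_conv_diff)
  have out1: "subst_word \<mu> out1 = g' @ (r @ p') @ winv g'"
    unfolding out1_def \<mu>_def by simp
  \<comment> \<open>The junction of \<open>g'\<close> with \<open>r p'\<close> also occurs in the word \<open>g u\<close>, which is known to be reduced.\<close>
  have n_p: "?n @ ?p = ?p @ ?n"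
    by (induction k) simp_all
  have "reduced (g' @ r @ ?n @ ?p)" using g_pos [of u] unfolding g_eq by simp
  moreover have "?n @ ?p = p' @ r @ ?n" using n_p p by (metis append.assoc)
  ultimately have "reduced ((g' @ r @ p') @ r @ ?n)" by (simp only: append.assoc)
  then have left: "reduced (g' @ r @ p')" by (rule reduced_appendD)
  have mid: "reduced ((r @ p') @ winv g')"
  proof (cases "g' = []")
    case False
    then have "hd (winv g') \<noteq> inv_letter (last p')"
      using p' by (auto simp: winv_def hd_rev last_map inv_letter_eq_iff)
    moreover have "reduced (r @ p')" using left by (rule reduced_appendD)
    moreover have "reduced g'" using g unfolding g_eq by (rule reduced_appendD)
    ultimately show ?thesis using p'(1) unfolding reduced_append [of "r @ p'" "winv g'"] by simp
  next
    case True
    then show ?thesis using left by simp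
  qed
  have red1: "reduced (g' @ (r @ p') @ winv g')"
    by (rule reduced_overlap [OF left mid]) (use p'(1) in simp)
  have "cls ?n + cls ?p = cls ?p + cls ?n" using n_p by (metis cls_append)
  then have "cls g + cls ?p - cls g = cls g' + cls r + (cls ?p + cls ?n) - cls g"
    unfolding g_eq by (simp add: cls_append add.assoc)
  also have "\<dots> = cls (g' @ (r @ p') @ winv g')"
    unfolding g_eq p by (simp add: cls_append cls_winv group_simps del: add_uminus_conv_diff)
  finally have conj_u: "conjugate u = g' @ (r @ p') @ winv g'"
    unfolding conjugate_def using red1 by (intro nf_unique) simp_all
  show ?thesis using \<mu> out1 out2 conj_u conj_v by metis
qed

definition sgn_word :: "bool \<Rightarrow> 'x letter list \<Rightarrow> 'x letter list" where
  "sgn_word e w = (if e then w else winv w)"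

lemma nf_signed: "nf (signed e x) = sgn_word e (nf x)"
  by (simp add: signed_def sgn_word_def nf_uminus)

lemma subst_sgn_word: "subst_word \<sigma> (sgn_word e w) = sgn_word e (subst_word \<sigma> w)"
  by (simp add: sgn_word_def subst_word_winv)

text \<open>Among all representations of the pair, one with the shortest conjugating word \<open>g\<close> is taken. Inverting the
  signs of both generators and reversing the positive words inverts both components, so
  the last letter of \<open>g\<close> may be assumed to be positive. The components cannot both end with it, because then
  a rotation would shorten \<open>g\<close>.\<close>
theorem machine_reaches_complete:
  assumes "conj_positive x y"
  shows "\<exists>\<mu> e1 e2. machine_reaches \<mu> \<and>
    (nf x = subst_word \<mu> (sgn_word e1 out1) \<and> nf y = subst_word \<mu> (sgn_word e2 out2) \<or>
     nf y = subst_word \<mu> (sgn_word e1 out1) \<and> nf x = subst_word \<mu> (sgn_word e2 out2))"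
proof -
  define rep where "rep g s u v e1 e2 \<longleftrightarrow> positive_basis u v \<and> reduced g \<and>
     x = signed e1 (cls g + cls (signed_word s u) - cls g) \<and>
     y = signed e2 (cls g + cls (signed_word s v) - cls g)" for g s u v e1 e2
  define Q where "Q g \<longleftrightarrow> (\<exists>s u v e1 e2. rep g s u v e1 e2)" for g
  have "\<exists>g. Q g"
  proof -
    obtain h s u v e1 e2 where "positive_basis u v"
      "x = h + signed e1 (cls (signed_word s u)) - h" "y = h + signed e2 (cls (signed_word s v)) - h"
      using assms unfolding conj_positive_def by blast
    then have "rep (nf h) s u v e1 e2" unfolding rep_def by (simp add: signed_conj)
    then show ?thesis unfolding Q_def by blast
  qed
  then obtain g where g: "Q g" and min: "\<And>g'. Q g' \<Longrightarrow> length g \<le> length g'"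
    using ex_has_least_nat [of Q _ length] by blast
  have flip: "rep g (\<lambda>c. \<not> s c) (rev u) (rev v) (\<not> e1) (\<not> e2)" if "rep g s u v e1 e2" for s u v e1 e2
  proof -
    have "signed (\<not> e) (h + cls (winv w) - h) = signed e (h + cls w - h)" for e h and w :: "gen letter list"
      by (simp add: signed_def cls_winv group_simps del: add_uminus_conv_diff)
    then show ?thesis using that unfolding rep_def
      by (metis positive_basis_rev winv_signed_word)
  qed
  obtain s u v e1 e2 where rep: "rep g s u v e1 e2" and pos: "g \<noteq> [] \<Longrightarrow> snd (last g) = s (fst (last g))"
    using g flip unfolding Q_def by (metis (full_types))
  then have uv: "positive_basis u v" and red: "reduced g"
    and x: "x = signed e1 (cls g + cls (signed_word s u) - cls g)"
    and y: "y = signed e2 (cls g + cls (signed_word s v) - cls g)"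
    unfolding rep_def by auto
  let ?c = "fst (last g)"
  have last_g: "last g = (?c, s ?c)" if "g \<noteq> []" by (simp add: prod_eq_iff flip: pos [OF that])
  have "g = [] \<or> last u \<noteq> ?c \<or> last v \<noteq> ?c"
  proof (rule ccontr)
    assume neg: "\<not> ?thesis"
    then obtain g' where g': "g = g' @ [(?c, s ?c)]" using last_g by (metis append_butlast_last_id)
    obtain u' v' where u': "u = u' @ [?c]" "v = v' @ [?c]"
      using neg positive_basis_nonempty [OF uv] by (metis append_butlast_last_id)
    have "positive_basis (?c # u') (?c # v')" using uv u' by (metis positive_basis_rotate)
    moreover have "cls g + cls (signed_word s (w @ [?c])) - cls g =
        cls g' + cls (signed_word s (?c # w)) - cls g'" for w
    proof -
      let ?l = "[(?c, s ?c)]"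
      have "cls g = cls g' + cls ?l" using g' by (metis cls_append)
      moreover have "cls (signed_word s (?c # w)) = cls ?l + cls (signed_word s w)"
        by (simp flip: cls_append)
      moreover have "cls (signed_word s (w @ [?c])) = cls (signed_word s w) + cls ?l"
        by (simp add: cls_append)
      ultimately show ?thesis by (simp only: group_simps) (simp add: group_simps del: add_uminus_conv_diff)
    qed
    moreover have "reduced g'" using red g' by (metis reduced_appendD(1))
    ultimately have "rep g' s (?c # u') (?c # v') e1 e2"
      unfolding rep_def using x y u' by metis
    then have "Q g'" unfolding Q_def by blast
    then have "length g \<le> length g'" by (rule min)
    moreover have "length g = Suc (length g')" using arg_cong [OF g', of length] by simp
    ultimately show False by simp
  qed
  then consider "g \<noteq> [] \<Longrightarrow> last v \<noteq> ?c" | "g \<noteq> [] \<Longrightarrow> last u \<noteq> ?c" by blast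
  then show ?thesis
  proof cases
    case 1
    then obtain \<mu> where "machine_reaches \<mu>" "subst_word \<mu> out1 = nf (cls g + cls (signed_word s u) - cls g)"
      "subst_word \<mu> out2 = nf (cls g + cls (signed_word s v) - cls g)"
      using machine_reaches_conj [OF uv red, of ?c s] last_g by blast
    then show ?thesis unfolding x y nf_signed subst_sgn_word by metis
  next
    case 2
    then obtain \<mu> where "machine_reaches \<mu>" "subst_word \<mu> out1 = nf (cls g + cls (signed_word s v) - cls g)"
      "subst_word \<mu> out2 = nf (cls g + cls (signed_word s u) - cls g)"
      using machine_reaches_conj [OF positive_basis.swap [OF uv] red, of ?c s] last_g by blast
    then show ?thesis unfolding x y nf_signed subst_sgn_word by metis
  qed
qed

instance hashed :: (finite) finite
proof
  have "x \<in> insert Hash (range Letter)" for x :: "'a hashed"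
    by (cases x) simp_all
  then have "UNIV \<subseteq> insert Hash (range Letter :: 'a hashed set)" by blast
  then show "finite (UNIV :: 'a hashed set)" by (rule finite_subset) simp
qed

section \<open>Free bases and primitive elements\<close>

lemma finite_updates: "finite updates"
  unfolding updates_def by simp

lemma emit_simps [simp]:
  "emit e v [] = []" "emit e v (Inl a # t) = a # emit e v t" "emit e v (t @ t') = emit e v t @ emit e v t'"
  "emit e v (map Inr w) = map e (subst_word v w)"
proof -
  show "emit e v (map Inr w) = map e (subst_word v w)"
  proof (induction w)
    case (Cons l w)
    then show ?case using subst_word_simps(4) [of v "[l]" w] by (simp add: emit_def)
  qed (simp add: emit_def)
qed (simp_all add: emit_def)

lemma free_basis_F2_pair:
  "free_basis F2 [w1, w2] \<longleftrightarrow> reduced w1 \<and> reduced w2 \<and> freely_generates [cls w1, cls w2]"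
  by (simp add: free_basis_F2_iff carrier_F2)

lemma free_basis_machine_reaches:
  assumes "free_basis F2 [w1, w2]"
  shows "\<exists>\<mu> e1 e2. machine_reaches \<mu> \<and>
    (w1 = subst_word \<mu> (sgn_word e1 out1) \<and> w2 = subst_word \<mu> (sgn_word e2 out2) \<or>
     w2 = subst_word \<mu> (sgn_word e1 out1) \<and> w1 = subst_word \<mu> (sgn_word e2 out2))"
proof -
  have "reduced w1" "reduced w2" "freely_generates [cls w1, cls w2]"
    using assms by (simp_all add: free_basis_F2_pair)
  then have "conj_positive (cls w1) (cls w2)"
    by (intro conj_positive_of_span) (simp add: freely_generates_pair)
  from machine_reaches_complete [OF this] show ?thesis
    using \<open>reduced w1\<close> \<open>reduced w2\<close> by (simp add: nf_cls reduce_reduced)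
qed

lemma machine_reaches_free_basis_signed:
  assumes "machine_reaches v"
  shows "freely_generates [cls (subst_word v (sgn_word e1 out1)), cls (subst_word v (sgn_word e2 out2))]"
proof -
  have "cls (sgn_word e w) = signed e (cls w)" for e and w :: "gen letter list"
    by (simp add: sgn_word_def signed_def cls_winv)
  then show ?thesis
    using machine_reaches_free_basis [OF assms]
    by (cases e1; cases e2)
      (auto simp: subst_sgn_word signed_def intro: freely_generates_uminus freely_generates_changes(2))
qed

text \<open>The templates cover the signs and the order of the two components. The relation \<open>compat\<close> says that
  two neighbours do not cancel; as the hash sign is compatible with everything, it expresses that both components
  are reduced.\<close>
lemma EDT0L_free_bases:
  "EDT0L (UNIV :: gen letter hashed set)
     {encode_tuple [w1, w2] | w1 w2. reduced w1 \<and> reduced w2 \<and> free_basis F2 [w1, w2]}"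
proof -
  define compat :: "gen letter hashed \<Rightarrow> gen letter hashed \<Rightarrow> bool" where
    "compat k l = (\<forall>a b. k = Letter a \<longrightarrow> l = Letter b \<longrightarrow> b \<noteq> inv_letter a)" for k l
  have [simp]: "compat (Letter a) (Letter b) \<longleftrightarrow> b \<noteq> inv_letter a" "compat Hash l" "compat l Hash" for a b l
    by (simp_all add: compat_def)
  have compat: "successively compat (encode_tuple [w1, w2]) \<longleftrightarrow> reduced w1 \<and> reduced w2" for w1 w2
    by (cases "w2 = []") (simp_all add: successively_append_iff successively_Cons successively_map
        reduced_def hd_map last_map)
  define tmpl :: "reg letter list \<Rightarrow> reg letter list \<Rightarrow> (gen letter hashed + reg letter) list" where
    "tmpl t1 t2 = map Inr t1 @ Inl Hash # map Inr t2" for t1 t2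
  define T where "T = (\<lambda>(e1, e2). tmpl (sgn_word e1 out1) (sgn_word e2 out2)) ` UNIV \<union>
    (\<lambda>(e1, e2). tmpl (sgn_word e2 out2) (sgn_word e1 out1)) ` UNIV"
  have emit: "emit Letter v (tmpl t1 t2) = encode_tuple [subst_word v t1, subst_word v t2]" for v t1 t2
    by (simp add: tmpl_def)
  let ?L = "{emit Letter v t | v t. machine_reaches v \<and> t \<in> T}"
  have "EDT0L UNIV ?L"
    by (rule EDT0L_word_machine [OF finite_updates]) (auto simp: T_def)
  then have "EDT0L UNIV (?L \<inter> {w \<in> lists UNIV. successively compat w})"
    by (rule EDT0L_Int_regular) (rule regular_language_successively [OF finite])
  also have "?L \<inter> {w \<in> lists UNIV. successively compat w} =
      {encode_tuple [w1, w2] | w1 w2. reduced w1 \<and> reduced w2 \<and> free_basis F2 [w1, w2]}" (is "_ = ?B")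
  proof (intro equalityI subsetI)
    fix w assume "w \<in> ?L \<inter> {w \<in> lists UNIV. successively compat w}"
    then obtain v t where v: "machine_reaches v" "t \<in> T" "w = emit Letter v t" "successively compat w" by blast
    from v(2) obtain e1 e2 where "t = tmpl (sgn_word e1 out1) (sgn_word e2 out2) \<or>
        t = tmpl (sgn_word e2 out2) (sgn_word e1 out1)" by (auto simp: T_def)
    then obtain w1 w2 where w: "w = encode_tuple [w1, w2]" "freely_generates [cls w1, cls w2]"
      using v(3) emit machine_reaches_free_basis_signed [OF v(1), of e1 e2] freely_generates_swap by metis
    then have "reduced w1" "reduced w2" using v(4) compat by auto
    then show "w \<in> ?B" using w free_basis_F2_pair by blast
  next
    fix w assume "w \<in> ?B"
    then obtain w1 w2 where w: "w = encode_tuple [w1, w2]" "reduced w1" "reduced w2" "free_basis F2 [w1, w2]"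
      by blast
    obtain \<mu> e1 e2 where \<mu>: "machine_reaches \<mu>"
      "w1 = subst_word \<mu> (sgn_word e1 out1) \<and> w2 = subst_word \<mu> (sgn_word e2 out2) \<or>
       w2 = subst_word \<mu> (sgn_word e1 out1) \<and> w1 = subst_word \<mu> (sgn_word e2 out2)"
      using free_basis_machine_reaches [OF w(4)] by blast
    have "tmpl (sgn_word e1 out1) (sgn_word e2 out2) \<in> T" "tmpl (sgn_word e2 out2) (sgn_word e1 out1) \<in> T"
      by (auto simp: T_def)
    then have "w \<in> ?L" using \<mu> w(1) emit by (smt (verit, best) mem_Collect_eq)
    then show "w \<in> ?L \<inter> {w \<in> lists UNIV. successively compat w}" using w compat by simp
  qed
  finally show ?thesis .
qed

lemma primitive_element_F2_iff: "primitive_element F2 w \<longleftrightarrow> (\<exists>w'. free_basis F2 [w, w'])"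
proof
  assume "primitive_element F2 w"
  then obtain gs where gs: "free_basis F2 gs" "w \<in> set gs" unfolding primitive_element_def by blast
  have "length (map cls gs) = 2"
    using gs(1) by (intro freely_generates_F2_length) (simp add: free_basis_F2_iff)
  then obtain u v where uv: "gs = [u, v]" by (auto simp: numeral_2_eq_2 length_Suc_conv)
  then have "free_basis F2 [v, u]"
    using gs(1) freely_generates_swap by (auto simp: free_basis_F2_pair)
  then show "\<exists>w'. free_basis F2 [w, w']" using gs uv by auto
qed (auto simp: primitive_element_def)

lemma EDT0L_primitive_elements:
  "EDT0L (UNIV :: gen letter set) {w. reduced w \<and> primitive_element F2 w}"
proof -
  define T :: "(gen letter + reg letter) list set" where
    "T = range (\<lambda>e. map Inr (sgn_word e out1)) \<union> range (\<lambda>e. map Inr (sgn_word e out2))"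
  let ?L = "{emit id v t | v t. machine_reaches v \<and> t \<in> T}" and ?M = "{w \<in> lists UNIV. successively (\<lambda>k l. l \<noteq> inv_letter k) w}"
  have "EDT0L UNIV ?L"
    by (rule EDT0L_word_machine [OF finite_updates]) (auto simp: T_def)
  then have "EDT0L UNIV (?L \<inter> ?M)"
    by (rule EDT0L_Int_regular) (rule regular_language_successively [OF finite])
  also have "?L \<inter> ?M = {w. reduced w \<and> primitive_element F2 w}" (is "_ = ?B")
  proof (intro equalityI subsetI)
    fix w assume "w \<in> ?L \<inter> ?M"
    then obtain v t where v: "machine_reaches v" "t \<in> T" "w = emit id v t" "reduced w"
      unfolding reduced_def by blast
    from v(2) obtain e where "t = map Inr (sgn_word e out1) \<or> t = map Inr (sgn_word e out2)"
      by (auto simp: T_def)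
    then have "w = subst_word v (sgn_word e out1) \<or> w = subst_word v (sgn_word e out2)" using v(3) by auto
    then obtain y where "freely_generates [cls w, y]"
      using machine_reaches_free_basis_signed [OF v(1), of e e] freely_generates_swap by metis
    then have "free_basis F2 [w, nf y]" using v(4) by (simp add: free_basis_F2_pair)
    then show "w \<in> ?B" using v(4) primitive_element_F2_iff by blast
  next
    fix w assume "w \<in> ?B"
    then obtain w' where w: "reduced w" "free_basis F2 [w, w']" using primitive_element_F2_iff by blast
    obtain \<mu> e where \<mu>: "machine_reaches \<mu>"
      "w = subst_word \<mu> (sgn_word e out1) \<or> w = subst_word \<mu> (sgn_word e out2)"
      using free_basis_machine_reaches [OF w(2)] by blast
    then have "w = emit id \<mu> (map Inr (sgn_word e out1)) \<or> w = emit id \<mu> (map Inr (sgn_word e out2))"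
      by simp
    moreover have "map Inr (sgn_word e out1) \<in> T" "map Inr (sgn_word e out2) \<in> T" by (auto simp: T_def)
    ultimately have "w \<in> ?L" using \<mu>(1) by blast
    then show "w \<in> ?L \<inter> ?M" using w(1) by (simp add: reduced_def)
  qed
  finally show ?thesis .
qed

theorem proposition9:
  shows "EDT0L (UNIV :: gen letter hashed set)
           {encode_tuple [w1, w2] | w1 w2. reduced w1 \<and> reduced w2 \<and> free_basis F2 [w1, w2]} \<and>
         EDT0L (UNIV :: gen letter set) {w. reduced w \<and> primitive_element F2 w}"
  using EDT0L_free_bases EDT0L_primitive_elements by blast

end
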